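(* Let $C\subset\mathbb{R}^n$ ($n\ge 2$) be a pointed closed convex cone with nonempty interior, and let $\Theta:C\setminus\{o\}\to(0,\infty)$ be continuous and homogeneous of degree $-q$, where $n-1<q<n$. Let $\varphi$ be a Borel measure on $\Omega_{C^\circ}$. Then there exists a $C$-pseudo-cone $K$ such that $\varphi$ is the $\Theta$-weighted cone-volume measure of $K$, that is, $V_K^\Theta=\varphi$, if and only if $\varphi$ is finite.
   Context: Work in Euclidean space $\mathbb{R}^n$, $n\ge 2$, with scalar product $\langle\cdot,\cdot\rangle$, origin $o$ and unit sphere $\mathbb{S}^{n-1}$; $\mathcal{H}^k$ is $k$-dimensional Hausdorff measure. A pseudo-cone is a nonempty closed convex set $K\subset\mathbb{R}^n$ with $o\notin K$ and $\lambda K\subseteq K$ for all $\lambda\ge 1$. Its recession cone is $\{z\in\mathbb{R}^n: K+\lambda z\subseteq K\ \forall\lambda\ge 0\}$, and $K$ is a $C$-pseudo-cone if its recession cone is $C$; then $K\subset C$. The dual cone is $C^\circ=\{x\in\mathbb{R}^n:\langle x,y\rangle\le 0\ \forall y\in C\}$, and $\Omega_{C^\circ}:=\mathbb{S}^{n-1}\cap\operatorname{int}C^\circ$. Homogeneity of degree $-q$ means $\Theta(\lambda y)=\lambda^{-q}\Theta(y)$ for $\lambda>0$. The $\Theta$-weighted Hausdorff measure is $\mathcal{H}_\Theta^n(\eta):=\int_\eta\Theta(y)\,\mathcal{H}^n(\mathrm{d}y)$ for Borel sets $\eta\subset\operatorname{int}C$. For a $C$-pseudo-cone $K$, $\nu_K(x)$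 denotes the outer unit normal vector of $K$ at those points $x\in\partial K$ where it is unique ($\mathcal{H}^{n-1}$-almost all points of $\partial K$), and $\nu_K^{-1}(\omega)$ is the set of such $x$ with $\nu_K(x)\in\omega$. The $\Theta$-weighted cone-volume measure of $K$ is the Borel measure on $\Omega_{C^\circ}$ given by $$V_K^\Theta(\omega):=\mathcal{H}_\Theta^n\Big(\bigcup_{x\in\nu_K^{-1}(\omega)}[o,x]\Big)$$ for Borel sets $\omega\subset\Omega_{C^\circ}$, where $[o,x]$ is the closed segment with endpoints $o$ and $x$ (the single point $o$ is a null set and is ignored). *)

theory Defs
  imports "HOL-Analysis.Analysis"
begin

definition pointed_closed_convex_cone :: "'a::euclidean_space set \<Rightarrow> bool" where
  "pointed_closed_convex_cone C \<longleftrightarrow>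
     C \<noteq> {} \<and> closed C \<and> convex C \<and> cone C \<and> (\<forall>x. x \<in> C \<and> - x \<in> C \<longrightarrow> x = 0)"

definition pseudo_cone :: "'a::euclidean_space set \<Rightarrow> bool" where
  "pseudo_cone K \<longleftrightarrow>
     K \<noteq> {} \<and> closed K \<and> convex K \<and> 0 \<notin> K \<and> (\<forall>t\<ge>1. \<forall>x\<in>K. t *\<^sub>R x \<in> K)"

definition recession_cone :: "'a::euclidean_space set \<Rightarrow> 'a set" where
  "recession_cone K = {z. \<forall>t\<ge>0. \<forall>x\<in>K. x + t *\<^sub>R z \<in> K}"

definition C_pseudo_cone :: "'a::euclidean_space set \<Rightarrow> 'a set \<Rightarrow> bool" where
  "C_pseudo_cone C K \<longleftrightarrow> pseudo_cone K \<and> recession_cone K = C"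

definition dual_cone :: "'a::euclidean_space set \<Rightarrow> 'a set" where
  "dual_cone C = {x. \<forall>y\<in>C. x \<bullet> y \<le> 0}"

definition Omega_dual :: "'a::euclidean_space set \<Rightarrow> 'a set" where
  "Omega_dual C = sphere 0 1 \<inter> interior (dual_cone C)"

definition outer_unit_normal :: "'a::euclidean_space set \<Rightarrow> 'a \<Rightarrow> 'a \<Rightarrow> bool" where
  "outer_unit_normal K x u \<longleftrightarrow> norm u = 1 \<and> (\<forall>y\<in>K. u \<bullet> (y - x) \<le> 0)"

(* Only meaningful at boundary points with exactly one outer unit normal. *)
definition gauss_map :: "'a::euclidean_space set \<Rightarrow> 'a \<Rightarrow> 'a" where
  "gauss_map K x = (THE u. outer_unit_normal K x u)"

definition reverse_gauss_image :: "'a::euclidean_space set \<Rightarrow> 'a set \<Rightarrow> 'a set" where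
  "reverse_gauss_image K \<omega> =
     {x \<in> frontier K. (\<exists>!u. outer_unit_normal K x u) \<and> gauss_map K x \<in> \<omega>}"

(* n-dimensional Hausdorff measure on an n-dimensional Euclidean space, in its standard
   normalization, is Lebesgue measure. *)
definition weighted_volume :: "('a::euclidean_space \<Rightarrow> real) \<Rightarrow> 'a set \<Rightarrow> ennreal" where
  "weighted_volume \<Theta> \<eta> = (\<integral>\<^sup>+ y \<in> \<eta>. ennreal (\<Theta> y) \<partial>lborel)"

(* The segments contain the origin, where the weight need not have a meaningful value;
   it contributes nothing to the integral, being a single point. *)
definition weighted_cone_volume ::
    "('a::euclidean_space \<Rightarrow> real) \<Rightarrow> 'a set \<Rightarrow> 'a set \<Rightarrow> ennreal" where
  "weighted_cone_volume \<Theta> K \<omega> =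
     weighted_volume \<Theta> (\<Union>x \<in> reverse_gauss_image K \<omega>. closed_segment 0 x)"

end

theory Submission
  imports Defs "HOL-Complex_Analysis.Great_Picard"
begin

text \<open>
  Let \<open>\<alpha> = n - q\<close>, so that the weighted volume of a dilate \<open>t A\<close> is \<open>t powr \<alpha>\<close> times that of \<open>A\<close>, and write \<open>h\<^sub>K\<close>
  for minus the support function of \<open>K\<close>. Since \<open>K\<close> contains a translate \<open>a + C\<close> and \<open>n - 1 < q < n\<close>, the weighted
  volume of \<open>C - K\<close> is finite; it bounds the cone-volume measure.

  Conversely, given a nonzero finite \<open>\<phi>\<close>, maximize the integral of \<open>ln h\<^sub>K\<close> against \<open>\<phi>\<close> among the \<open>C\<close>-pseudo-cones
  for which \<open>C - K\<close> has weighted volume at most \<open>\<phi>(\<Omega>)\<close>. As \<open>C - K\<close> contains the part of \<open>C\<close> in the ball of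
  radius \<open>h\<^sub>K(u)\<close>, the functions \<open>h\<^sub>K\<close> are uniformly bounded, a subsequence of a maximizing sequence converges
  pointwise, and Fatou's lemma produces a maximizer \<open>K\<close>, whose volume constraint is active by scaling. For a compact
  set \<open>F\<close> of normals, move the supporting halfspaces with normals in \<open>F\<close> outwards by the factor \<open>1 + s\<close>. Comparing
  with the maximizer as \<open>s\<close> tends to \<open>0\<close> bounds \<open>\<phi>(F)\<close> by the weighted volume of the points of \<open>C - K\<close> on rays
  that leave through a boundary point having a normal in \<open>F\<close>. Almost every ray meets a boundary point with a unique
  normal, so inner regularity gives that \<open>\<phi>\<close> is at most the cone-volume measure; as the latter has total mass at most
  \<open>\<phi>(\<Omega>)\<close>, they coincide. For \<open>\<phi> = 0\<close> take \<open>K = a + C\<close>: its only boundary point with a normal in \<open>\<Omega>\<close> is the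
  apex, where the normal is not unique.
\<close>

section \<open>Measure-theoretic preliminaries\<close>

lemma dyadic_between:
  fixes y :: real assumes "1 \<le> y" obtains k :: nat where "2 ^ k \<le> y" "y \<le> 2 ^ Suc k"
proof -
  define n where "n = (LEAST n::nat. y < 2 ^ n)"
  have ex: "\<exists>n::nat. y < 2 ^ n" using real_arch_pow[of 2 y] by auto
  have n: "y < 2 ^ n" unfolding n_def by (rule LeastI_ex[OF ex])
  then have "n \<noteq> 0" using assms by (metis leD power_0)
  then obtain k where k: "n = Suc k" using not0_implies_Suc by blast
  have "\<not> y < 2 ^ k" using not_less_Least[of k "\<lambda>n. y < 2 ^ n"] k unfolding n_def by auto
  then show ?thesis using that[of k] n k by simp
qed

lemma null_sets_frontier_convex:
  "convex (S :: 'a::euclidean_space set) \<Longrightarrow> frontier S \<in> null_sets lborel"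
  using negligible_convex_frontier[of S] frontier_closed[of S]
  by (auto simp: negligible_iff_null_sets null_sets_completion_iff)

lemma nn_integral_lborel_scale:
  fixes f :: "'a::euclidean_space \<Rightarrow> ennreal"
  assumes [measurable]: "f \<in> borel_measurable borel" and t: "t > 0"
  shows "integral\<^sup>N lborel f = ennreal (t ^ DIM('a)) * (\<integral>\<^sup>+x. f (t *\<^sub>R x) \<partial>lborel)"
proof -
  have "integral\<^sup>N lborel f = integral\<^sup>N (density (distr lborel borel (\<lambda>x. 0 + t *\<^sub>R x)) (\<lambda>_. \<bar>t\<bar> ^ DIM('a))) f"
    using lborel_affine[of t "0::'a"] t by simp
  then show ?thesis using t
    by (simp add: nn_integral_density nn_integral_distr nn_integral_cmult)
qed

lemma borel_image_scaleR:
  fixes A :: "'a::euclidean_space set"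
  assumes "A \<in> sets borel" "t \<noteq> 0" shows "(*\<^sub>R) t ` A \<in> sets borel"
proof -
  have "(*\<^sub>R) t ` A = (\<lambda>x. (1/t) *\<^sub>R x) -` A \<inter> space borel" using assms(2) by force
  also have "\<dots> \<in> sets borel" using assms(1) by (intro measurable_sets[of _ borel borel]) auto
  finally show ?thesis .
qed

lemma borel_image_plus:
  fixes A :: "'a::euclidean_space set"
  assumes "A \<in> sets borel" shows "(+) a ` A \<in> sets borel"
proof -
  have "(+) a ` A = (\<lambda>x. x - a) -` A \<inter> space borel" by force
  also have "\<dots> \<in> sets borel" using assms(1) by (intro measurable_sets[of _ borel borel]) auto
  finally show ?thesis .
qed

lemma emeasure_lborel_translate:
  fixes A :: "'a::euclidean_space set"
  assumes "A \<in> sets borel" shows "emeasure lborel ((+) a ` A) = emeasure lborel A"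
proof -
  have "emeasure lborel A = emeasure (distr lborel borel ((+) (- a))) A"
    using lborel_distr_plus[of "-a"] by simp
  also have "\<dots> = emeasure lborel ((+) (- a) -` A)" using assms by (subst emeasure_distr) auto
  also have "(+) (- a) -` A = (+) a ` A" by force
  finally show ?thesis by simp
qed

text \<open>Otherwise infinitely many disjoint translates of equal positive measure would fit into a ball.\<close>

lemma null_sets_one_per_line:
  fixes A :: "'a::euclidean_space set"
  assumes A: "A \<in> sets borel" and line: "\<And>x t. x \<in> A \<Longrightarrow> t > 0 \<Longrightarrow> x + t *\<^sub>R e \<notin> A"
  shows "A \<in> null_sets lborel"
proof -
  have "emeasure lborel (A \<inter> ball 0 (real R)) = 0" for R :: nat
  proof -
    define D where "D = A \<inter> ball 0 (real R)"
    have D: "D \<in> sets borel" using A by (auto simp: D_def)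
    \<comment> \<open>The shifts \<open>1 / (j + 1)\<close> are distinct, so the line condition
      separates the translates, and at most 1, so all of them stay in one ball.\<close>
    define V where "V = (\<lambda>j::nat. (+) ((1 / real (Suc j)) *\<^sub>R e) ` D)"
    have V: "V j \<in> sets borel" for j unfolding V_def by (rule borel_image_plus[OF D])
    have dis: "V i \<inter> V j = {}" if "i < j" for i j
    proof -
      have "1 / real (Suc j) < 1 / real (Suc i)" using that by (simp add: frac_less2)
      then have t: "1 / real (Suc i) - 1 / real (Suc j) > 0" by simp
      have False if "x \<in> D" "y \<in> D" "(1 / real (Suc i)) *\<^sub>R e + x = (1 / real (Suc j)) *\<^sub>R e + y" for x y
      proof -
        have "y = x + (1 / real (Suc i) - 1 / real (Suc j)) *\<^sub>R e"
          using that(3) by (simp add: scaleR_diff_left algebra_simps)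
        then show False using line[OF _ t, of x] that by (auto simp: D_def)
      qed
      then show ?thesis unfolding V_def by blast
    qed
    have disj: "disjoint_family_on V {..<n}" for n
      unfolding disjoint_family_on_def using dis by (metis Int_commute linorder_neqE_nat)
    define L where "L = measure lborel (cball (0::'a) (real R + norm e))"
    have L: "emeasure lborel (cball (0::'a) (real R + norm e)) = ennreal L"
      unfolding L_def using emeasure_lborel_cball_finite[of "0::'a" "real R + norm e"] by (auto simp: emeasure_eq_ennreal_measure)
    have n: "of_nat n * emeasure lborel D \<le> ennreal L" for n
    proof -
      have "of_nat n * emeasure lborel D = (\<Sum>j<n. emeasure lborel (V j))"
        by (simp add: V_def emeasure_lborel_translate[OF D])
      also have "\<dots> = emeasure lborel (\<Union>j<n. V j)"
        using V disj by (intro sum_emeasure) auto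
      also have "\<dots> \<le> emeasure lborel (cball (0::'a) (real R + norm e))"
      proof (intro emeasure_mono)
        show "(\<Union>j<n. V j) \<subseteq> cball 0 (real R + norm e)"
        proof
          fix x assume "x \<in> (\<Union>j<n. V j)"
          then obtain j y where j: "y \<in> D" "x = (1 / real (Suc j)) *\<^sub>R e + y" by (auto simp: V_def)
          have "norm ((1 / real (Suc j)) *\<^sub>R e) \<le> norm e" by (simp add: divide_le_eq distrib_left)
          moreover have "norm y \<le> real R" using j(1) by (simp add: D_def)
          ultimately show "x \<in> cball 0 (real R + norm e)"
            using norm_triangle_ineq[of "(1 / real (Suc j)) *\<^sub>R e" y] j(2) by simp
        qed
      qed auto
      finally show ?thesis using L by simp
    qed
    show ?thesis
    proof (rule ccontr)
      assume "\<not> ?thesis"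
      then have pos: "emeasure lborel D > 0" by (simp add: D_def zero_less_iff_neq_zero)
      have "emeasure lborel D \<le> ennreal L" using n[of 1] by simp
      then obtain m where m: "emeasure lborel D = ennreal m" "m > 0"
        using pos by (cases "emeasure lborel D") (auto simp: top_unique)
      obtain n :: nat where "L / m < real n" using reals_Archimedean2 by blast
      then have "L < real n * m" using m(2) by (simp add: field_simps)
      moreover have "ennreal (real n * m) \<le> ennreal L"
        using n[of n] m by (simp add: ennreal_mult' ennreal_of_nat_eq_real_of_nat)
      moreover have "L \<ge> 0" by (simp add: L_def)
      ultimately show False by (simp add: ennreal_le_iff)
    qed
  qed
  then have "(\<Union>R::nat. A \<inter> ball 0 (real R)) \<in> null_sets lborel"
    using A by (intro null_sets_UN) (auto simp: null_sets_def)
  moreover have "(\<Union>R::nat. A \<inter> ball 0 (real R)) = A" using reals_Archimedean2 by auto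
  ultimately show ?thesis by simp
qed

text \<open>Meant for dyadic shells, both towards the origin and towards infinity, whose masses
  decay geometrically.\<close>

lemma emeasure_geometric_finite:
  assumes "\<And>k. A k \<in> sets M" "0 \<le> b" "0 \<le> r" "r < 1" "\<And>k. emeasure M (A k) \<le> ennreal (b * r ^ k)"
  shows "emeasure M (\<Union>k. A k) < \<infinity>"
proof -
  have "emeasure M (\<Union>k. A k) \<le> (\<Sum>k. emeasure M (A k))"
    using assms(1) by (intro emeasure_subadditive_countably) auto
  also have "\<dots> \<le> (\<Sum>k. ennreal (b * r ^ k))" using assms(5) by (intro suminf_le) auto
  also have "\<dots> = ennreal (\<Sum>k. b * r ^ k)"
    using assms by (intro suminf_ennreal2 summable_mult summable_geometric) auto
  finally show ?thesis using order.strict_trans1[OF _ ennreal_less_top] by simp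
qed

text \<open>Lower semicontinuity in the form that Fatou's lemma needs. As \<open>ln 0 = 0\<close> in
  HOL, the infinite value at a vanishing limit has to be set separately.\<close>

lemma liminf_log:
  fixes g :: "nat \<Rightarrow> real"
  assumes g: "\<And>n. g n > 0" "g \<longlonglongrightarrow> l"
  shows "(if l = 0 then \<infinity> else ennreal (c - ln l)) \<le> liminf (\<lambda>n. ennreal (c - ln (g n)))"
proof (cases "l = 0")
  case True
  have "filterlim g (at_right 0) sequentially"
    using g True order.strict_implies_not_eq[OF g(1)] by (simp add: filterlim_at)
  then have bot: "filterlim (\<lambda>n. ln (g n)) at_bot sequentially"
    using ln_at_0 filterlim_compose by blast
  then have "filterlim (\<lambda>n. c + - ln (g n)) at_top sequentially"
    by (intro filterlim_tendsto_add_at_top[OF tendsto_const]) (simp add: filterlim_uminus_at_top)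
  then have "(\<lambda>n. ennreal (c + - ln (g n))) \<longlonglongrightarrow> top"
    by (simp add: ennreal_tendsto_top_eq_at_top)
  then have "liminf (\<lambda>n. ennreal (c - ln (g n))) = top"
    using lim_imp_Liminf[OF sequentially_bot] by simp
  then show ?thesis by simp
next
  case False
  have "(\<lambda>n. ennreal (c - ln (g n))) \<longlonglongrightarrow> ennreal (c - ln l)"
    using g(2) False by (intro tendsto_ennrealI tendsto_intros)
  then show ?thesis using False lim_imp_Liminf[OF sequentially_bot] by fastforce
qed

section \<open>Solid cones and their pseudo-cones\<close>

locale solid_cone =
  fixes C :: "'a::euclidean_space set"
  assumes cone_C: "pointed_closed_convex_cone C"
    and solid: "interior C \<noteq> {}"
begin

lemma closed_C: "closed C" and convex_C: "convex C"
  and pointed_C: "x \<in> C \<Longrightarrow> - x \<in> C \<Longrightarrow> x = 0"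
  and add_C: "x \<in> C \<Longrightarrow> y \<in> C \<Longrightarrow> x + y \<in> C"
  and scale_C: "x \<in> C \<Longrightarrow> 0 \<le> t \<Longrightarrow> t *\<^sub>R x \<in> C"
  using cone_C convex_cone[of C] unfolding pointed_closed_convex_cone_def by auto

lemma zero_C: "0 \<in> C"
  using solid scale_C[of _ 0] interior_subset by fastforce

lemma interior_C_D: "x \<in> interior C \<Longrightarrow> x \<in> C"
  using interior_subset by blast

lemma add_interior_C: assumes "x \<in> interior C" "y \<in> C" shows "x + y \<in> interior C"
proof -
  have "(+) y ` interior C \<subseteq> C" using assms(2) add_C interior_subset by blast
  moreover have "open ((+) y ` interior C)" by (simp add: open_translation)
  ultimately have "(+) y ` interior C \<subseteq> interior C" by (simp add: interior_maximal)
  then show ?thesis using assms(1) by (auto simp: add.commute)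
qed

lemma scale_interior_C: assumes "x \<in> interior C" "0 < t" shows "t *\<^sub>R x \<in> interior C"
proof -
  have "(*\<^sub>R) t ` interior C \<subseteq> C" using assms(2) scale_C interior_subset by fastforce
  moreover have "open ((*\<^sub>R) t ` interior C)" using assms by (intro open_scaling) auto
  ultimately have "(*\<^sub>R) t ` interior C \<subseteq> interior C" by (simp add: interior_maximal)
  then show ?thesis using assms(1) by auto
qed

lemma scale_interior_C_iff: "0 < t \<Longrightarrow> t *\<^sub>R x \<in> interior C \<longleftrightarrow> x \<in> interior C"
  using scale_interior_C[of x t] scale_interior_C[of "t *\<^sub>R x" "1/t"] by auto

text \<open>If \<open>cball u e\<close> lies in the dual cone, then so does \<open>u\<close> moved
  by length \<open>e\<close> in direction \<open>y\<close>; testing that vector on \<open>y\<close>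
  gives the bound with \<open>c = e\<close>.\<close>

lemma interior_dual_gap:
  assumes "u \<in> interior (dual_cone C)"
  obtains c where "c > 0" "\<And>y. y \<in> C \<Longrightarrow> c * norm y \<le> - (u \<bullet> y)"
proof -
  obtain e where e: "e > 0" "cball u e \<subseteq> dual_cone C"
    using assms mem_interior_cball by blast
  have "e * norm y \<le> - (u \<bullet> y)" if "y \<in> C" for y
  proof (cases "y = 0")
    case False
    have "u + (e / norm y) *\<^sub>R y \<in> cball u e" using False e by (simp add: dist_norm)
    then have "(u + (e / norm y) *\<^sub>R y) \<bullet> y \<le> 0" using e that unfolding dual_cone_def by blast
    then show ?thesis using False by (simp add: inner_add_left dot_square_norm power2_eq_square)
  qed simp
  then show ?thesis using that e by blast
qed

text \<open>Moving \<open>x'\<close> by \<open>d / 2\<close> against \<open>p\<close> stays in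
  \<open>C\<close>, where \<open>p\<close> is nonnegative. The same constant serves all
  \<open>p\<close> and all \<open>x'\<close> near \<open>x\<close>, as the compactness argument for
  contact vectors requires.\<close>

lemma interior_gap:
  assumes "x \<in> interior C"
  obtains c e where "c > 0" "e > 0"
    "\<And>x' p. dist x x' < e \<Longrightarrow> (\<And>y. y \<in> C \<Longrightarrow> 0 \<le> p \<bullet> y) \<Longrightarrow> c * norm p \<le> p \<bullet> x'"
proof -
  obtain d where d: "d > 0" "cball x d \<subseteq> C" using assms mem_interior_cball by blast
  have "(d/2) * norm p \<le> p \<bullet> x'" if "dist x x' < d/2" and p: "\<And>y. y \<in> C \<Longrightarrow> 0 \<le> p \<bullet> y" for x' p
  proof (cases "p = 0")
    case False
    have "dist x (x' - (d / 2 / norm p) *\<^sub>R p) \<le> dist x x' + norm ((d / 2 / norm p) *\<^sub>R p)"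
      by (metis dist_norm dist_triangle add_diff_cancel_left' diff_add_cancel)
    also have "\<dots> \<le> d" using that False d by simp
    finally have "x' - (d / 2 / norm p) *\<^sub>R p \<in> C" using d by auto
    then have "0 \<le> p \<bullet> (x' - (d / 2 / norm p) *\<^sub>R p)" using p by blast
    then show ?thesis using False by (simp add: inner_diff_right dot_square_norm power2_eq_square)
  qed simp
  then show ?thesis using that[of "d/2" "d/2"] d by simp
qed

lemma zero_not_interior: "0 \<notin> interior C"
proof
  assume "0 \<in> interior C"
  then obtain d where d: "d > 0" "cball 0 d \<subseteq> C" using mem_interior_cball by blast
  obtain b :: 'a where b: "b \<in> Basis" using nonempty_Basis by blast
  have "d *\<^sub>R b \<in> C" "- (d *\<^sub>R b) \<in> C" using d b by auto
  then have "d *\<^sub>R b = 0" using pointed_C by blast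
  then show False using d b by auto
qed

lemma interior_nonzero: "x \<in> interior C \<Longrightarrow> x \<noteq> 0"
  using zero_not_interior by blast

text \<open>Turns the condition on the recession cone into invariance under adding elements of
  \<open>C\<close>. The inclusion \<open>K \<subseteq> C\<close> holds because averaging
  \<open>y \<in> K\<close> with a far multiple of \<open>k \<in> K\<close> yields
  \<open>y + t k\<close> in the limit.\<close>

lemma C_pseudo_cone_iff:
  "C_pseudo_cone C K \<longleftrightarrow> K \<noteq> {} \<and> closed K \<and> convex K \<and> 0 \<notin> K \<and> K \<subseteq> C \<and> (\<forall>x\<in>K. \<forall>z\<in>C. x + z \<in> K)"
  (is "?L \<longleftrightarrow> ?R")
proof
  assume L: ?L
  then have K: "K \<noteq> {}" "closed K" "convex K" "0 \<notin> K" and sc: "\<And>t x. t \<ge> 1 \<Longrightarrow> x \<in> K \<Longrightarrow> t *\<^sub>R x \<in> K"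
    and rec: "recession_cone K = C"
    unfolding C_pseudo_cone_def pseudo_cone_def by auto
  have plus: "x + z \<in> K" if "x \<in> K" "z \<in> C" for x z
    using that rec unfolding recession_cone_def by (auto dest: spec[of _ 1])
  have "k \<in> C" if k: "k \<in> K" for k
  proof -
    have "y + t *\<^sub>R k \<in> K" if t: "t \<ge> 0" and y: "y \<in> K" for t y
    proof (cases "t = 0")
      case False
      \<comment> \<open>The small weight \<open>1 / (n + 1)\<close> cancels the factor of the far
        point \<open>(n + 1) t k\<close>, which belongs to \<open>K\<close> as soon as
        \<open>(n + 1) t \<ge> 1\<close>.\<close>
      define s where "s = (\<lambda>n. (1 - 1 / real (Suc n)) *\<^sub>R y + (1 / real (Suc n)) *\<^sub>R ((real (Suc n) * t) *\<^sub>R k))"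
      have s: "s = (\<lambda>n. (1 - 1 / real (Suc n)) *\<^sub>R y + t *\<^sub>R k)" by (auto simp: s_def)
      have "(\<lambda>n. 1 / real (Suc n)) \<longlonglongrightarrow> 0" using LIMSEQ_inverse_real_of_nat by (simp add: inverse_eq_divide)
      then have "(\<lambda>n. (1 - 1 / real (Suc n)) *\<^sub>R y + t *\<^sub>R k) \<longlonglongrightarrow> (1 - 0) *\<^sub>R y + t *\<^sub>R k"
        by (intro tendsto_intros)
      then have lim: "s \<longlonglongrightarrow> y + t *\<^sub>R k" unfolding s by simp
      obtain N where N: "1 / t \<le> real N" using real_arch_simple by blast
      have "s n \<in> K" if "n \<ge> N" for n
      proof -
        have "1 / t \<le> real (Suc n)" using N that by simp
        then have "real (Suc n) * t \<ge> 1" using t False by (simp add: field_simps)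
        then show ?thesis unfolding s_def using sc k y
          by (intro convexD[OF K(3)]) auto
      qed
      then show ?thesis using lim K(2) closed_sequentially
        by (metis (no_types, lifting) LIMSEQ_ignore_initial_segment le_add2)
    qed (use y in simp)
    then show ?thesis using rec unfolding recession_cone_def by blast
  qed
  then show ?R using K plus by blast
next
  assume R: ?R
  have sc: "t *\<^sub>R x \<in> K" if "t \<ge> 1" "x \<in> K" for t x
  proof -
    have "x + (t - 1) *\<^sub>R x \<in> K" using R that scale_C by auto
    then show ?thesis by (simp add: algebra_simps)
  qed
  have "z \<in> C" if z: "\<forall>t\<ge>0. \<forall>x\<in>K. x + t *\<^sub>R z \<in> K" for z
  proof -
    obtain x where x: "x \<in> K" using R by blast
    \<comment> \<open>Dividing \<open>x + (n + 1) z \<in> C\<close> by \<open>n + 1\<close> exhibits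
      \<open>z\<close> as a limit of points of the closed cone \<open>C\<close>.\<close>
    have "(1 / real (Suc n)) *\<^sub>R x + z \<in> C" for n
    proof -
      have "x + real (Suc n) *\<^sub>R z \<in> K" using z x by (metis of_nat_0_le_iff)
      then have "x + real (Suc n) *\<^sub>R z \<in> C" using R by blast
      then have "(1 / real (Suc n)) *\<^sub>R (x + real (Suc n) *\<^sub>R z) \<in> C" by (intro scale_C) auto
      then show ?thesis by (simp add: scaleR_add_right)
    qed
    moreover have "(\<lambda>n. 1 / real (Suc n)) \<longlonglongrightarrow> 0" using LIMSEQ_inverse_real_of_nat by (simp add: inverse_eq_divide)
    then have "(\<lambda>n. (1 / real (Suc n)) *\<^sub>R x + z) \<longlonglongrightarrow> 0 *\<^sub>R x + z" by (intro tendsto_intros)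
    ultimately show ?thesis using closed_sequentially[OF closed_C, of "\<lambda>n. (1 / real (Suc n)) *\<^sub>R x + z"] by simp
  qed
  then have "recession_cone K = C" unfolding recession_cone_def using R scale_C by blast
  then show ?L unfolding C_pseudo_cone_def pseudo_cone_def using R sc by blast
qed

end

section \<open>Elementary geometry of one pseudo-cone\<close>

locale pseudo_cone_in = solid_cone C for C :: "'a::euclidean_space set" +
  fixes K :: "'a set"
  assumes K: "C_pseudo_cone C K"
begin

lemma nonempty_K: "K \<noteq> {}" and closed_K: "closed K" and convex_K: "convex K" and zero_K: "0 \<notin> K"
  and K_subset_C: "K \<subseteq> C" and plus_K: "x \<in> K \<Longrightarrow> z \<in> C \<Longrightarrow> x + z \<in> K"
  using K unfolding C_pseudo_cone_iff by auto

lemma scale_K: assumes "1 \<le> t" "x \<in> K" shows "t *\<^sub>R x \<in> K"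
  using assms K unfolding C_pseudo_cone_def pseudo_cone_def by blast

lemma dist_zero_K: obtains d where "d > 0" "\<And>x. x \<in> K \<Longrightarrow> d \<le> norm x"
proof -
  obtain d where "d > 0" "\<forall>x\<in>K. d \<le> dist 0 x" using separate_point_closed[OF closed_K zero_K] by blast
  then show ?thesis using that by simp
qed

lemma plus_interior_K: assumes "x \<in> K" "y \<in> interior C" shows "x + y \<in> interior K"
proof -
  have "(+) x ` interior C \<subseteq> K" using assms(1) plus_K interior_subset by blast
  moreover have "open ((+) x ` interior C)" by (simp add: open_translation)
  ultimately have "(+) x ` interior C \<subseteq> interior K" by (simp add: interior_maximal)
  then show ?thesis using assms(2) by auto
qed

lemma scale_interior_K: assumes "1 < t" "x \<in> K" "x \<in> interior C" shows "t *\<^sub>R x \<in> interior K"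
proof -
  have "x + (t - 1) *\<^sub>R x \<in> interior K" using assms by (intro plus_interior_K scale_interior_C) auto
  then show ?thesis by (simp add: algebra_simps)
qed

lemma scale_interior_K': assumes "1 \<le> t" "x \<in> interior K" shows "t *\<^sub>R x \<in> interior K"
proof -
  have "(*\<^sub>R) t ` interior K \<subseteq> K" using assms scale_K interior_subset by blast
  moreover have "open ((*\<^sub>R) t ` interior K)" using assms by (intro open_scaling) auto
  ultimately have "(*\<^sub>R) t ` interior K \<subseteq> interior K" by (simp add: interior_maximal)
  then show ?thesis using assms(2) by auto
qed

end

section \<open>The weighted measure\<close>

locale weighted_cone = solid_cone C for C :: "'a::euclidean_space set" +
  fixes \<Theta> :: "'a \<Rightarrow> real" and q :: real
  assumes dim2: "DIM('a) \<ge> 2"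
    and cont_\<Theta>: "continuous_on (C - {0}) \<Theta>"
    and pos_\<Theta>: "\<And>y. y \<in> C - {0} \<Longrightarrow> \<Theta> y > 0"
    and hom_\<Theta>: "\<And>y t. y \<in> C - {0} \<Longrightarrow> t > 0 \<Longrightarrow> \<Theta> (t *\<^sub>R y) = t powr (- q) * \<Theta> y"
    and q_gt: "real DIM('a) - 1 < q" and q_less: "q < real DIM('a)"
begin

definition \<alpha> :: real where "\<alpha> = real DIM('a) - q"

lemma \<alpha>: "0 < \<alpha>" "\<alpha> < 1"
  using q_gt q_less by (auto simp: \<alpha>_def)

text \<open>Cut off outside \<open>C - {0}\<close>, where \<Theta> is arbitrary, so that it is Borel
  on the whole space and homogeneous at every point.\<close>

definition weight :: "'a \<Rightarrow> ennreal" where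
  "weight x = ennreal (\<Theta> x) * indicator (C - {0}) x"

definition \<mu> :: "'a measure" where "\<mu> = density lborel weight"

lemma weight_measurable [measurable]: "weight \<in> borel_measurable borel"
proof -
  have "C - {0} \<in> sets borel" using closed_C by auto
  then have "(\<lambda>x. indicator (C - {0}) x *\<^sub>R \<Theta> x) \<in> borel_measurable borel"
    using cont_\<Theta> by (rule borel_measurable_continuous_on_indicator)
  then have "(\<lambda>x. ennreal (indicator (C - {0}) x *\<^sub>R \<Theta> x)) \<in> borel_measurable borel" by measurable
  also have "(\<lambda>x. ennreal (indicator (C - {0}) x *\<^sub>R \<Theta> x)) = weight"
    by (auto simp: weight_def indicator_def)
  finally show ?thesis .
qed

lemma sets_\<mu> [simp, measurable_cong]: "sets \<mu> = sets borel" and space_\<mu> [simp]: "space \<mu> = UNIV"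
  by (auto simp: \<mu>_def)

lemma emeasure_\<mu>: "A \<in> sets borel \<Longrightarrow> emeasure \<mu> A = (\<integral>\<^sup>+x. weight x * indicator A x \<partial>lborel)"
  unfolding \<mu>_def by (subst emeasure_density) auto

lemma null_\<mu>: "A \<in> null_sets lborel \<Longrightarrow> A \<in> null_sets \<mu>"
  unfolding \<mu>_def by (rule absolutely_continuousI_density[unfolded absolutely_continuous_def, THEN subsetD]) auto

lemma weight_scale: "t > 0 \<Longrightarrow> weight (t *\<^sub>R x) = ennreal (t powr (- q)) * weight x"
proof -
  assume t: "t > 0"
  have "t *\<^sub>R x \<in> C \<longleftrightarrow> x \<in> C"
    using t scale_C[of x t] scale_C[of "t *\<^sub>R x" "1/t"] by auto
  then show ?thesis using t hom_\<Theta>[of x t] by (auto simp: weight_def indicator_def ennreal_mult')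
qed

text \<open>The Jacobian contributes the exponent \<open>DIM('a)\<close>, the homogeneity of the
  weight the exponent \<open>- q\<close>.\<close>

lemma emeasure_\<mu>_scale:
  assumes "A \<in> sets borel" "t > 0"
  shows "emeasure \<mu> ((*\<^sub>R) t ` A) = ennreal (t powr \<alpha>) * emeasure \<mu> A"
proof -
  have tA: "(*\<^sub>R) t ` A \<in> sets borel" using assms by (intro borel_image_scaleR) auto
  have "emeasure \<mu> ((*\<^sub>R) t ` A) = (\<integral>\<^sup>+x. weight x * indicator ((*\<^sub>R) t ` A) x \<partial>lborel)"
    by (rule emeasure_\<mu>[OF tA])
  also have "\<dots> = ennreal (t ^ DIM('a)) * (\<integral>\<^sup>+x. weight (t *\<^sub>R x) * indicator ((*\<^sub>R) t ` A) (t *\<^sub>R x) \<partial>lborel)"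
    using tA assms(2) by (intro nn_integral_lborel_scale) auto
  also have "(\<lambda>x. weight (t *\<^sub>R x) * indicator ((*\<^sub>R) t ` A) (t *\<^sub>R x)) = (\<lambda>x. ennreal (t powr (- q)) * (weight x * indicator A x))"
    using assms(2) by (force simp: weight_scale indicator_def mult.assoc)
  also have "(\<integral>\<^sup>+x. ennreal (t powr (- q)) * (weight x * indicator A x) \<partial>lborel) = ennreal (t powr (- q)) * emeasure \<mu> A"
    using assms by (subst nn_integral_cmult) (auto simp: emeasure_\<mu>)
  finally show ?thesis using assms(2)
    by (simp add: mult.assoc[symmetric] ennreal_mult'[symmetric] \<alpha>_def powr_realpow[symmetric] powr_add[symmetric])
qed

text \<open>By compactness \<Theta> is bounded on the part of \<open>C\<close> in this shell;
  dilations reduce all other shells to it.\<close>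

lemma emeasure_\<mu>_shell_le:
  obtains B where "B > 0" "\<And>A. A \<in> sets borel \<Longrightarrow> A \<subseteq> {x. 1 \<le> norm x \<and> norm x \<le> 2} \<Longrightarrow>
    emeasure \<mu> A \<le> ennreal B * emeasure lborel A"
proof -
  have eq: "C \<inter> (cball 0 2 - ball 0 1) = C \<inter> cball 0 2 \<inter> - ball 0 1" by auto
  have "compact (C \<inter> (cball 0 2 - ball 0 1))" unfolding eq
    by (intro compact_Int_closed closed_Int_compact closed_C compact_cball) auto
  then have "compact (\<Theta> ` (C \<inter> (cball 0 2 - ball 0 1)))"
    by (intro compact_continuous_image continuous_on_subset[OF cont_\<Theta>]) auto
  then obtain B where B: "B > 0" "\<And>x. x \<in> C \<inter> (cball 0 2 - ball 0 1) \<Longrightarrow> norm (\<Theta> x) \<le> B"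
    using bounded_pos compact_imp_bounded by (metis imageI)
  have "emeasure \<mu> A \<le> ennreal B * emeasure lborel A"
    if A: "A \<in> sets borel" "A \<subseteq> {x. 1 \<le> norm x \<and> norm x \<le> 2}" for A
  proof -
    have "emeasure \<mu> A = (\<integral>\<^sup>+x. weight x * indicator A x \<partial>lborel)" by (rule emeasure_\<mu>[OF A(1)])
    also have "\<dots> \<le> (\<integral>\<^sup>+x. ennreal B * indicator A x \<partial>lborel)"
    proof (intro nn_integral_mono)
      fix x show "weight x * indicator A x \<le> ennreal B * indicator A x"
        using B(2)[of x] A(2) by (auto simp: weight_def indicator_def intro!: ennreal_leI)
    qed
    also have "\<dots> = ennreal B * emeasure lborel A" using A(1) by (subst nn_integral_cmult) auto
    finally show ?thesis .
  qed
  then show ?thesis using that B(1) by blast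
qed

text \<open>The punctured ball is covered by the dilates of one shell by
  \<open>1 / 2 ^ (k + 1)\<close>. Their masses form a geometric series of ratio
  \<open>(1/2) powr \<alpha>\<close>, which converges because \<open>q < n\<close>.\<close>

lemma \<mu>_cball_1_finite: "emeasure \<mu> (cball 0 1) < \<infinity>"
proof -
  define A :: "'a set" where "A = cball 0 2 - ball 0 1"
  have A: "A \<in> sets borel" by (auto simp: A_def)
  obtain B where B: "B > 0" "\<And>A. A \<in> sets borel \<Longrightarrow> A \<subseteq> {x. 1 \<le> norm x \<and> norm x \<le> 2} \<Longrightarrow>
    emeasure \<mu> A \<le> ennreal B * emeasure lborel A" using emeasure_\<mu>_shell_le by blast
  have "emeasure \<mu> A \<le> ennreal B * emeasure lborel A" using A by (intro B) (auto simp: A_def)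
  also have "\<dots> \<le> ennreal B * emeasure lborel (cball (0::'a) 2)"
    by (intro mult_left_mono emeasure_mono) (auto simp: A_def)
  also have "\<dots> < \<infinity>"
    using emeasure_lborel_cball_finite[of "0::'a" 2] by (auto simp: ennreal_mult_less_top)
  finally have fA: "emeasure \<mu> A < \<infinity>" .
  then obtain b where b: "b \<ge> 0" "emeasure \<mu> A = ennreal b" by (cases "emeasure \<mu> A") auto
  define S where "S = (\<lambda>k::nat. (*\<^sub>R) (1 / 2 ^ Suc k) ` A)"
  have S: "S k \<in> sets borel" for k unfolding S_def by (intro borel_image_scaleR A) auto
  have pw: "(1 / 2 ^ Suc k) powr \<alpha> = (1/2) powr \<alpha> * ((1/2) powr \<alpha>) ^ k" for k
  proof -
    have "(1 / 2 ^ Suc k) powr \<alpha> = ((1/2) powr real (Suc k)) powr \<alpha>"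
      by (simp add: powr_realpow power_divide del: of_nat_Suc power_Suc)
    also have "\<dots> = ((1/2) powr \<alpha>) powr real (Suc k)" by (simp add: powr_powr mult.commute)
    also have "\<dots> = ((1/2) powr \<alpha>) ^ Suc k" by (subst powr_realpow) auto
    finally show ?thesis by simp
  qed
  have "emeasure \<mu> (\<Union>k. S k) < \<infinity>"
  proof (rule emeasure_geometric_finite)
    show "(1/2) powr \<alpha> < (1::real)" using \<alpha> powr_less_mono2[of \<alpha> "1/2" 1] by simp
    show "emeasure \<mu> (S k) \<le> ennreal (((1/2) powr \<alpha> * b) * ((1/2) powr \<alpha>) ^ k)" for k
      unfolding S_def using A b by (subst emeasure_\<mu>_scale) (auto simp: pw ennreal_mult'[symmetric] mult_ac simp del: power_Suc)
  qed (use S b in auto)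
  moreover have "cball 0 1 - {0} \<subseteq> (\<Union>k. S k)"
  proof
    fix x :: 'a assume x: "x \<in> cball 0 1 - {0}"
    then obtain k where k: "2 ^ k \<le> 1 / norm x" "1 / norm x \<le> 2 ^ Suc k"
      using dyadic_between[of "1 / norm x"] by (auto simp: field_simps)
    have "2 ^ Suc k *\<^sub>R x \<in> A" using k x by (auto simp: A_def field_simps)
    then have "(1 / 2 ^ Suc k) *\<^sub>R (2 ^ Suc k *\<^sub>R x) \<in> S k" unfolding S_def by blast
    then show "x \<in> (\<Union>k. S k)" by (auto simp del: power_Suc)
  qed
  ultimately have "emeasure \<mu> (cball 0 1 - {0}) < \<infinity>"
    using S by (intro order.strict_trans1[OF emeasure_mono[of "cball 0 1 - {0}" "\<Union>k. S k"]]) auto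
  moreover have "{0} \<in> null_sets \<mu>" by (intro null_\<mu>) auto
  ultimately have "emeasure \<mu> ((cball 0 1 - {0}) \<union> {0}) < \<infinity>"
    by (subst emeasure_Un_null_set) auto
  moreover have "(cball 0 1 - {0}) \<union> {0} = cball (0::'a) 1" by auto
  ultimately show ?thesis by simp
qed

text \<open>Positivity comes from a small ball inside \<open>interior C\<close>, close to the
  origin, on which the weight is positive.\<close>

lemma \<mu>_ball_1: "emeasure \<mu> (ball 0 1) < \<infinity>" "0 < emeasure \<mu> (ball 0 1)"
proof -
  show "emeasure \<mu> (ball 0 1) < \<infinity>"
    using emeasure_mono[of "ball 0 1" "cball 0 1" \<mu>] \<mu>_cball_1_finite by (simp add: ball_subset_cball order.strict_trans1)
  show "0 < emeasure \<mu> (ball 0 1)"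
  proof (rule ccontr)
    assume "\<not> ?thesis"
    then have "(\<integral>\<^sup>+x. weight x * indicator (ball 0 1) x \<partial>lborel) = 0" by (simp add: emeasure_\<mu>)
    moreover have "(\<lambda>x. weight x * indicator (ball 0 1) x) \<in> borel_measurable lborel"
      using weight_measurable by (intro borel_measurable_times_ennreal borel_measurable_indicator) auto
    ultimately have ae: "AE x in lborel. weight x * indicator (ball 0 1) x = 0"
      using nn_integral_0_iff_AE by blast
    obtain x where x: "x \<in> interior C" using solid by blast
    define y where "y = (1 / (2 * norm x)) *\<^sub>R x"
    have nx: "norm x > 0" using interior_nonzero x by auto
    have y: "y \<in> interior C \<inter> ball 0 1" using x nx by (auto simp: y_def intro!: scale_interior_C)
    have "open (interior C \<inter> ball (0::'a) 1)" by auto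
    then obtain e where e: "e > 0" "ball y e \<subseteq> interior C \<inter> ball 0 1" using y open_contains_ball by blast
    have "AE x in lborel. x \<notin> ball y e"
      using ae
    proof (eventually_elim)
      fix x assume "weight x * indicator (ball 0 1) x = 0"
      moreover have "x \<in> ball y e \<Longrightarrow> x \<in> C - {0} \<and> x \<in> ball 0 1"
        using e interior_C_D interior_nonzero by blast
      ultimately show "x \<notin> ball y e" using pos_\<Theta>[of x] by (auto simp: weight_def indicator_def ennreal_eq_0_iff split: if_splits)
    qed
    then have "emeasure lborel (ball y e) = 0"
      by (subst (asm) AE_iff_measurable[OF _ refl]) (auto simp: ball_def)
    then show False using e content_ball_pos[of e y] by (simp add: measure_def)
  qed
qed

text \<open>Disjoint translates of the collar by multiples of \<^term>\<open>(1 / 2 ^ k) *\<^sub>R a\<close> fit into a fixed ball. Together with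
  \<^term>\<open>\<alpha> < 1\<close> this makes the masses of the dyadic shells summable.\<close>

lemma lborel_collar_le:
  fixes k :: nat
  assumes a: "a \<in> C"
  shows "emeasure lborel {x\<in>C. norm x \<le> 2 \<and> x - (1 / 2 ^ k) *\<^sub>R a \<notin> C} * 2 ^ k \<le> emeasure lborel (cball (0::'a) (2 + norm a))"
proof -
  define \<epsilon> :: real where "\<epsilon> = 1 / 2 ^ k"
  have \<epsilon>: "\<epsilon> > 0" by (simp add: \<epsilon>_def)
  define U where "U = {x\<in>C. norm x \<le> 2 \<and> x - \<epsilon> *\<^sub>R a \<notin> C}"
  have "U = C \<inter> cball 0 2 - (+) (\<epsilon> *\<^sub>R a) ` C" by (force simp: U_def)
  moreover have "closed ((+) (\<epsilon> *\<^sub>R a) ` C)" using closed_C by (simp add: closed_translation)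
  ultimately have U: "U \<in> sets borel" using closed_C by auto
  define V where "V = (\<lambda>j::nat. (+) ((real j * \<epsilon>) *\<^sub>R a) ` U)"
  have V: "V j \<in> sets borel" for j unfolding V_def by (rule borel_image_plus[OF U])
  have VU: "x \<in> V j \<longleftrightarrow> x - (real j * \<epsilon>) *\<^sub>R a \<in> U" for x j
    unfolding V_def by (metis (no_types, lifting) add_diff_cancel_left' image_iff le_add_diff_inverse add.commute diff_add_cancel)
  have dis: False if "i < j" "x \<in> V i" "x \<in> V j" for i j x
  proof -
    have 1: "x - (real i * \<epsilon>) *\<^sub>R a - \<epsilon> *\<^sub>R a \<notin> C" and 2: "x - (real j * \<epsilon>) *\<^sub>R a \<in> C"
      using that by (auto simp: VU U_def)
    \<comment> \<open>For \<open>i < j\<close> the coefficient \<open>j - i - 1\<close> is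
      nonnegative, so the sum stays in \<open>C\<close>; this contradicts membership of
      \<open>x\<close> in \<open>V i\<close>.\<close>
    have "(x - (real j * \<epsilon>) *\<^sub>R a) + ((real j - real i - 1) * \<epsilon>) *\<^sub>R a \<in> C"
      using 2 a that(1) \<epsilon> by (intro add_C scale_C) auto
    also have "(x - (real j * \<epsilon>) *\<^sub>R a) + ((real j - real i - 1) * \<epsilon>) *\<^sub>R a = x - (real i * \<epsilon>) *\<^sub>R a - \<epsilon> *\<^sub>R a"
      by (simp add: algebra_simps)
    finally show False using 1 by simp
  qed
  have disj: "disjoint_family_on V {..<2 ^ k}"
    unfolding disjoint_family_on_def using dis by (metis disjoint_iff linorder_neqE_nat)
  have "emeasure lborel U * 2 ^ k = (\<Sum>j<2 ^ k. emeasure lborel (V j))"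
    by (simp add: V_def emeasure_lborel_translate[OF U] mult.commute)
  also have "\<dots> = emeasure lborel (\<Union>j<2 ^ k. V j)"
    using V disj by (intro sum_emeasure) auto
  also have "\<dots> \<le> emeasure lborel (cball (0::'a) (2 + norm a))"
  proof (intro emeasure_mono)
    show "(\<Union>j<2 ^ k. V j) \<subseteq> cball 0 (2 + norm a)"
    proof
      fix x assume "x \<in> (\<Union>j<2 ^ k. V j)"
      then obtain j y where j: "j < 2 ^ k" "y \<in> U" "x = (real j * \<epsilon>) *\<^sub>R a + y" by (auto simp: V_def)
      have "real j < 2 ^ k" using j(1) by (metis of_nat_less_iff of_nat_numeral of_nat_power)
      then have "real j * \<epsilon> \<le> 1" by (simp add: \<epsilon>_def)
      then have "norm ((real j * \<epsilon>) *\<^sub>R a) \<le> norm a" using \<epsilon> by (simp add: mult_left_le_one_le)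
      moreover have "norm y \<le> 2" using j(2) by (simp add: U_def)
      ultimately show "x \<in> cball 0 (2 + norm a)" using norm_triangle_ineq[of "(real j * \<epsilon>) *\<^sub>R a" y] j(3) by simp
    qed
  qed auto
  finally show ?thesis by (simp add: U_def \<epsilon>_def)
qed

text \<open>Shrinking the shell of radii \<open>2 ^ k\<close> to \<open>2 ^ (k + 1)\<close> to the
  standard one turns the translation vector into \<open>a / 2 ^ k\<close>, so the collar there has
  Lebesgue measure of order \<open>1 / 2 ^ k\<close>. Dilating back costs the factor
  \<open>2 powr (k \<alpha>)\<close>, and the ratio \<open>2 powr \<alpha> / 2\<close> is below 1
  because \<open>q > n - 1\<close>.\<close>

lemma \<mu>_translate_finite:
  assumes a: "a \<in> C" shows "emeasure \<mu> (C - (+) a ` C) < \<infinity>"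
proof -
  define L where "L = measure lborel (cball (0::'a) (2 + norm a))"
  have L: "emeasure lborel (cball (0::'a) (2 + norm a)) = ennreal L" "L \<ge> 0"
    unfolding L_def using emeasure_lborel_cball_finite[of "0::'a" "2 + norm a"] by (auto simp: emeasure_eq_ennreal_measure)
  obtain B where B: "B > 0" "\<And>A. A \<in> sets borel \<Longrightarrow> A \<subseteq> {x. 1 \<le> norm x \<and> norm x \<le> 2} \<Longrightarrow>
    emeasure \<mu> A \<le> ennreal B * emeasure lborel A" using emeasure_\<mu>_shell_le by blast
  define T where "T = (\<lambda>k::nat. {x\<in>C. 1 \<le> norm x \<and> norm x \<le> 2 \<and> x - (1 / 2 ^ k) *\<^sub>R a \<notin> C})"
  have bor: "{x\<in>C. l \<le> norm x \<and> norm x \<le> 2 \<and> x - e *\<^sub>R a \<notin> C} \<in> sets borel" for l e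
  proof -
    have "{x\<in>C. l \<le> norm x \<and> norm x \<le> 2 \<and> x - e *\<^sub>R a \<notin> C} = C \<inter> cball 0 2 \<inter> - ball 0 l - (+) (e *\<^sub>R a) ` C"
      by (force simp: )
    moreover have "closed ((+) (e *\<^sub>R a) ` C)" using closed_C by (simp add: closed_translation)
    ultimately show ?thesis using closed_C by auto
  qed
  have T: "T k \<in> sets borel" for k unfolding T_def by (rule bor)
  define S where "S = (\<lambda>k::nat. (*\<^sub>R) (2 ^ k) ` T k)"
  have S: "S k \<in> sets borel" for k unfolding S_def by (intro borel_image_scaleR T) auto
  have lT: "emeasure lborel (T k) \<le> ennreal (L * (1/2) ^ k)" for k
  proof -
    have "{x\<in>C. norm x \<le> 2 \<and> x - (1 / 2 ^ k) *\<^sub>R a \<notin> C} = {x\<in>C. 0 \<le> norm x \<and> norm x \<le> 2 \<and> x - (1 / 2 ^ k) *\<^sub>R a \<notin> C}" by auto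
    then have "emeasure lborel (T k) \<le> emeasure lborel {x\<in>C. norm x \<le> 2 \<and> x - (1 / 2 ^ k) *\<^sub>R a \<notin> C}"
      using bor[of 0 "1 / 2 ^ k"] by (intro emeasure_mono) (auto simp: T_def)
    moreover have e2: "emeasure lborel {x\<in>C. norm x \<le> 2 \<and> x - (1 / 2 ^ k) *\<^sub>R a \<notin> C} * ennreal (2 ^ k) \<le> ennreal L"
      using lborel_collar_le[OF a, of k] L by (simp add: ennreal_power[symmetric])
    ultimately have "emeasure lborel (T k) * ennreal (2 ^ k) \<le> ennreal L"
      by (meson dual_order.trans mult_right_mono zero_le)
    then have "emeasure lborel (T k) * ennreal (2 ^ k) * ennreal ((1/2) ^ k) \<le> ennreal L * ennreal ((1/2) ^ k)"
      by (intro mult_right_mono) auto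
    then show ?thesis using L(2)
      by (simp add: mult.assoc ennreal_mult[symmetric] power_divide)
  qed
  have "emeasure \<mu> (\<Union>k. S k) < \<infinity>"
  proof (rule emeasure_geometric_finite)
    show "2 powr \<alpha> / 2 < (1::real)" using \<alpha> powr_less_mono[of \<alpha> 1 2] by simp
    show "emeasure \<mu> (S k) \<le> ennreal ((B * L) * (2 powr \<alpha> / 2) ^ k)" for k
    proof -
      have "emeasure \<mu> (S k) = ennreal ((2 ^ k) powr \<alpha>) * emeasure \<mu> (T k)"
        unfolding S_def using T by (subst emeasure_\<mu>_scale) auto
      also have "\<dots> \<le> ennreal ((2 ^ k) powr \<alpha>) * (ennreal B * ennreal (L * (1/2) ^ k))"
        by (intro mult_left_mono order.trans[OF B(2)] lT T) (auto simp: T_def)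
      also have "\<dots> = ennreal ((2 ^ k) powr \<alpha> * (B * (L * (1/2) ^ k)))"
        using B(1) L(2) by (simp add: ennreal_mult[symmetric])
      also have "(2 ^ k) powr \<alpha> = (2 powr \<alpha>) ^ k"
        by (simp add: powr_realpow[symmetric] powr_powr mult.commute)
      also have "(2 powr \<alpha>) ^ k * (B * (L * (1/2) ^ k)) = (B * L) * (2 powr \<alpha> / 2) ^ k"
        by (simp add: power_divide)
      finally show ?thesis .
    qed
  qed (use S B L in auto)
  then have "emeasure \<mu> ((\<Union>k. S k) \<union> cball 0 1) < \<infinity>"
    using S \<mu>_cball_1_finite by (intro order.strict_trans1[OF emeasure_subadditive]) auto
  moreover have "emeasure \<mu> (C - (+) a ` C) \<le> emeasure \<mu> ((\<Union>k. S k) \<union> cball 0 1)"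
  proof (rule emeasure_mono, rule subsetI)
    fix x assume x: "x \<in> C - (+) a ` C"
    show "x \<in> (\<Union>k. S k) \<union> cball 0 1"
    proof (cases "norm x \<le> 1")
      case False
      then obtain k where k: "2 ^ k \<le> norm x" "norm x \<le> 2 ^ Suc k"
        using dyadic_between[of "norm x"] by auto
      define y where "y = (1 / 2 ^ k) *\<^sub>R x"
      have "y - (1 / 2 ^ k) *\<^sub>R a \<notin> C"
      proof
        assume "y - (1 / 2 ^ k) *\<^sub>R a \<in> C"
        then have "2 ^ k *\<^sub>R (y - (1 / 2 ^ k) *\<^sub>R a) \<in> C" by (intro scale_C) auto
        then have "x - a \<in> C" by (simp add: y_def scaleR_diff_right)
        then have "a + (x - a) \<in> (+) a ` C" by blast
        then show False using x by simp
      qed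
      moreover have "y \<in> C" using x by (auto simp: y_def intro!: scale_C)
      moreover have "1 \<le> norm y" "norm y \<le> 2" using k by (auto simp: y_def field_simps)
      ultimately have "y \<in> T k" by (auto simp: T_def)
      moreover have "x = 2 ^ k *\<^sub>R y" by (simp add: y_def)
      ultimately show ?thesis by (auto simp: S_def)
    qed auto
  next
    show "(\<Union>k. S k) \<union> cball 0 1 \<in> sets \<mu>" using S by (intro sets.Un sets.countable_UN) auto
  qed
  ultimately show ?thesis by (rule order.strict_trans1[rotated])
qed

lemma \<mu>_complement_finite:
  assumes "C_pseudo_cone C K" shows "emeasure \<mu> (C - K) < \<infinity>"
proof -
  interpret pseudo_cone_in C K by unfold_locales fact
  obtain a where a: "a \<in> K" using nonempty_K by blast
  have "C - K \<subseteq> C - (+) a ` C" using a plus_K by blast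
  moreover have "closed ((+) a ` C)" using closed_C by (simp add: closed_translation)
  ultimately have "emeasure \<mu> (C - K) \<le> emeasure \<mu> (C - (+) a ` C)"
    using closed_C by (intro emeasure_mono) auto
  also have "\<dots> < \<infinity>" using a K_subset_C by (intro \<mu>_translate_finite) auto
  finally show ?thesis .
qed

end

section \<open>Support functions of pseudo-cones\<close>

context solid_cone
begin

text \<open>Minus the support function.\<close>

definition gap :: "'a set \<Rightarrow> 'a \<Rightarrow> real" where
  "gap K u = (INF x\<in>K. - (u \<bullet> x))"

text \<open>Makes the facts on solid cones available for the dual cone. It is pointed since a vector
  in it together with its negative is orthogonal to \<open>C\<close>, which has interior
  points.\<close>

lemma solid_cone_dual: assumes "interior (dual_cone C) \<noteq> {}" shows "solid_cone (dual_cone C)"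
proof
  have "dual_cone C = (\<Inter>y\<in>C. {x. x \<bullet> y \<le> 0})" by (auto simp: dual_cone_def)
  moreover have "closed {x. x \<bullet> y \<le> 0}" for y :: 'a
    using closed_halfspace_le[of y 0] by (simp add: inner_commute)
  ultimately have "closed (dual_cone C)" by auto
  moreover have "x + y \<in> dual_cone C" if "x \<in> dual_cone C" "y \<in> dual_cone C" for x y
    using that by (auto simp: dual_cone_def inner_add_left intro: add_nonpos_nonpos)
  then have "convex (dual_cone C)" "cone (dual_cone C)"
    using convex_cone[of "dual_cone C"] by (auto simp: dual_cone_def mult_nonneg_nonpos)
  moreover have "x = 0" if "x \<in> dual_cone C" "- x \<in> dual_cone C" for x
  proof -
    obtain y where "y \<in> interior C" using solid by blast
    then obtain c e where ce: "c > 0" "e > 0"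
      "\<And>x' p. dist y x' < e \<Longrightarrow> (\<And>y. y \<in> C \<Longrightarrow> 0 \<le> p \<bullet> y) \<Longrightarrow> c * norm p \<le> p \<bullet> x'" using interior_gap by blast
    have z: "x \<bullet> z = 0" if "z \<in> C" for z using that \<open>x \<in> dual_cone C\<close> \<open>- x \<in> dual_cone C\<close>
      by (force simp: dual_cone_def)
    have "y \<in> C" using \<open>y \<in> interior C\<close> interior_subset by blast
    then have "c * norm x \<le> 0" using ce(3)[of y x] ce(2) z by auto
    then show ?thesis using ce(1) by (simp add: mult_le_0_iff)
  qed
  moreover have "0 \<in> dual_cone C" by (simp add: dual_cone_def)
  ultimately show "pointed_closed_convex_cone (dual_cone C)"
    unfolding pointed_closed_convex_cone_def by blast
qed fact

lemma Omega_dual_D: "u \<in> Omega_dual C \<Longrightarrow> u \<in> interior (dual_cone C)" "u \<in> Omega_dual C \<Longrightarrow> norm u = 1"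
  by (auto simp: Omega_dual_def)

lemma Omega_borel: "Omega_dual C \<in> sets borel"
  unfolding Omega_dual_def by (intro sets.Int borel_closed borel_open) auto

lemma dual_interior_D: "u \<in> interior (dual_cone C) \<Longrightarrow> u \<in> dual_cone C"
  using interior_subset by blast

end

context pseudo_cone_in
begin

lemma gap_le: assumes "u \<in> dual_cone C" "x \<in> K" shows "gap K u \<le> - (u \<bullet> x)"
  unfolding gap_def using assms K_subset_C
  by (intro cINF_lower bdd_belowI2[of _ 0]) (auto simp: dual_cone_def)

lemma gap_ge: assumes "\<And>x. x \<in> K \<Longrightarrow> c \<le> - (u \<bullet> x)" shows "c \<le> gap K u"
  unfolding gap_def using assms nonempty_K by (intro cINF_greatest) auto

lemma gap_nonneg: "u \<in> dual_cone C \<Longrightarrow> 0 \<le> gap K u"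
  using K_subset_C by (intro gap_ge) (auto simp: dual_cone_def)

lemma gap_pos: assumes "u \<in> interior (dual_cone C)" shows "0 < gap K u"
proof -
  obtain c where c: "c > 0" "\<And>y. y \<in> C \<Longrightarrow> c * norm y \<le> - (u \<bullet> y)" using interior_dual_gap[OF assms] by blast
  obtain d where d: "d > 0" "\<And>x. x \<in> K \<Longrightarrow> d \<le> norm x" using dist_zero_K by blast
  have "c * d \<le> gap K u"
  proof (rule gap_ge)
    fix x assume x: "x \<in> K"
    have "c * d \<le> c * norm x" using c(1) d(2)[OF x] by simp
    then show "c * d \<le> - (u \<bullet> x)" using c(2)[of x] x K_subset_C by force
  qed
  then show ?thesis using c(1) d(1) by (meson mult_pos_pos order_less_le_trans)
qed

lemma gap_add: assumes "u \<in> dual_cone C" "v \<in> dual_cone C" shows "gap K u + gap K v \<le> gap K (u + v)"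
proof (rule gap_ge)
  fix x assume "x \<in> K"
  then show "gap K u + gap K v \<le> - ((u + v) \<bullet> x)"
    using gap_le[OF assms(1)] gap_le[OF assms(2)] by (fastforce simp: inner_add_left)
qed

lemma gap_scale_ge: assumes "u \<in> dual_cone C" "0 \<le> t" shows "t * gap K u \<le> gap K (t *\<^sub>R u)"
proof (rule gap_ge)
  fix x assume "x \<in> K"
  then show "t * gap K u \<le> - ((t *\<^sub>R u) \<bullet> x)"
    using gap_le[OF assms(1)] mult_left_mono[of "gap K u" "- (u \<bullet> x)" t] assms(2) by fastforce
qed

lemma gap_scale: assumes "u \<in> dual_cone C" "0 < t" shows "gap K (t *\<^sub>R u) = t * gap K u"
proof -
  have "t *\<^sub>R u \<in> dual_cone C" using assms by (auto simp: dual_cone_def mult_nonneg_nonpos)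
  then have "(1/t) * gap K (t *\<^sub>R u) \<le> gap K u" using gap_scale_ge[of "t *\<^sub>R u" "1/t"] assms by simp
  then show ?thesis using gap_scale_ge[of u t] assms by (simp add: field_simps)
qed

text \<open>Monotonicity in the order of the dual cone takes the place of equicontinuity when
  convergence is extended from a dense set.\<close>

lemma gap_mono_cone: assumes "u \<in> dual_cone C" "v - u \<in> dual_cone C" shows "gap K u \<le> gap K v"
  using gap_add[OF assms] gap_nonneg[OF assms(2)] by simp

text \<open>An infimum of linear functions has superlevel sets that are intersections of closed
  halfspaces.\<close>

lemma gap_measurable: "gap K \<in> borel_measurable (restrict_space borel (Omega_dual C))"
proof (rule borel_measurableI_ge)
  fix c
  have "{u \<in> space (restrict_space borel (Omega_dual C)). c \<le> gap K u}
      = Omega_dual C \<inter> (\<Inter>x\<in>K. {u. c \<le> - (u \<bullet> x)})"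
  proof -
    have "c \<le> gap K u \<longleftrightarrow> (\<forall>x\<in>K. c \<le> - (u \<bullet> x))" if "u \<in> Omega_dual C" for u
      using gap_le[of u] gap_ge[of c u] that Omega_dual_D dual_interior_D by (meson order_trans)
    then show ?thesis by (auto simp: space_restrict_space)
  qed
  moreover have "closed {u::'a. c \<le> - (u \<bullet> x)}" for x
    using closed_halfspace_le[of x "-c"] by (simp add: inner_commute le_minus_iff)
  then have "closed (\<Inter>x\<in>K. {u. c \<le> - (u \<bullet> x)})" by auto
  ultimately show "{u \<in> space (restrict_space borel (Omega_dual C)). c \<le> gap K u} \<in> sets (restrict_space borel (Omega_dual C))"
    using Omega_borel by (auto simp: sets_restrict_space)
qed

text \<open>Cauchy-Schwarz. This is how a bound on the volume of \<open>C - K\<close> will bound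
  \<open>gap K\<close>.\<close>

lemma ball_gap_subset: assumes "u \<in> dual_cone C" "norm u \<le> 1" shows "ball 0 (gap K u) \<inter> K = {}"
proof -
  have "gap K u \<le> norm x" if "x \<in> K" for x
  proof -
    have "- (u \<bullet> x) \<le> norm u * norm x" using Cauchy_Schwarz_ineq2[of u x] by linarith
    also have "\<dots> \<le> norm x" using assms(2) by (simp add: mult_left_le_one_le)
    finally show ?thesis using gap_le[OF assms(1) that] by simp
  qed
  then show ?thesis by force
qed

end

section \<open>Compactness of gap functions and Wulff shapes\<close>

context solid_cone
begin

text \<open>A diagonal argument gives convergence on a countable dense set. Any other
  \<open>u\<close> is squeezed, in the order of the dual cone, by a point \<open>d\<close> of that
  set between \<open>(1 - \<delta>) u\<close> and \<open>(1 + \<delta>) u\<close>, uniformly in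
  \<open>n\<close>.\<close>

lemma gap_convergent_subsequence:
  assumes Kn: "\<And>n. C_pseudo_cone C (Kn n)"
    and bnd: "\<And>n u. u \<in> interior (dual_cone C) \<Longrightarrow> gap (Kn n) u \<le> M * norm u"
  obtains k h where "strict_mono (k::nat\<Rightarrow>nat)"
    "\<And>u. u \<in> interior (dual_cone C) \<Longrightarrow> (\<lambda>n. gap (Kn (k n)) u) \<longlonglongrightarrow> h u"
proof (cases "interior (dual_cone C) = {}")
  case True
  then show ?thesis using that[of id] by (auto simp: strict_mono_id)
next
  case False
  interpret D: solid_cone "dual_cone C" using solid_cone_dual[OF False] .
  have pc: "pseudo_cone_in C (Kn n)" for n by unfold_locales (rule Kn)
  note g = pseudo_cone_in.gap_nonneg[OF pc] pseudo_cone_in.gap_mono_cone[OF pc]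
    pseudo_cone_in.gap_scale[OF pc]
  obtain D :: "'a set" where D: "countable D" "\<And>X. open X \<Longrightarrow> X \<noteq> {} \<Longrightarrow> \<exists>d\<in>D. d \<in> X"
    using countable_dense_setE by blast
  define S where "S = D \<inter> interior (dual_cone C)"
  \<comment> \<open>Division by \<open>norm u\<close> makes the bound independent of
    \<open>u\<close>, as the diagonal selection requires.\<close>
  have "norm (gap (Kn n) u / norm u) \<le> M" if "u \<in> S" for n u
  proof -
    have u: "u \<in> interior (dual_cone C)" using that by (simp add: S_def)
    then have "u \<noteq> 0" by (rule D.interior_nonzero)
    then show ?thesis using bnd[OF u, of n] g(1)[OF D.interior_C_D[OF u], of n]
      by (simp add: divide_le_eq)
  qed
  moreover have "countable S" using D by (simp add: S_def)
  ultimately obtain k where k: "strict_mono (k::nat\<Rightarrow>nat)"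
    "\<And>u. u \<in> S \<Longrightarrow> \<exists>l. (\<lambda>n. gap (Kn (k n)) u / norm u) \<longlonglongrightarrow> l"
    using function_convergent_subsequence[of S "\<lambda>n u. gap (Kn n) u / norm u" M] by blast
  have "convergent (\<lambda>n. gap (Kn (k n)) u)" if u: "u \<in> interior (dual_cone C)" for u
  proof -
    have u0: "u \<in> dual_cone C" "u \<noteq> 0" using u D.interior_C_D D.interior_nonzero by auto
    have M: "M \<ge> 0" using bnd[OF u, of 0] g(1)[OF u0(1), of 0] u0(2)
      by (metis norm_ge_zero norm_le_zero_iff order_trans zero_le_mult_iff)
    have "Cauchy (\<lambda>n. gap (Kn (k n)) u)"
    proof (rule metric_CauchyI)
      fix e :: real assume e: "e > 0"
      \<comment> \<open>Below 1, so that \<open>(1 - \<delta>) u\<close> stays in the dual cone, and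
        small enough that \<open>\<delta>\<close> times any of the gaps at \<open>u\<close> is at
        most \<open>e / 3\<close>; the summand 1 guards against a zero denominator.\<close>
      define \<delta> where "\<delta> = min (1/2) (e / (3 * (M * norm u + 1)))"
      have Mu: "M * norm u \<ge> 0" using M by simp
      have \<delta>: "0 < \<delta>" "\<delta> < 1" using e Mu by (auto simp: \<delta>_def)
      have "\<delta> * (M * norm u) \<le> (e / (3 * (M * norm u + 1))) * (M * norm u)"
        using Mu by (intro mult_right_mono) (auto simp: \<delta>_def)
      also have "\<dots> \<le> e / 3" using Mu e by (simp add: field_simps)
      finally have \<delta>e: "\<delta> * (M * norm u) \<le> e / 3" .
      \<comment> \<open>The open order interval between \<open>(1 - \<delta>) u\<close> and
        \<open>(1 + \<delta>) u\<close>, a neighbourhood of \<open>u\<close> which the dense set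
        therefore meets.\<close>
      define X where "X = (\<lambda>d. d - (1 - \<delta>) *\<^sub>R u) -` interior (dual_cone C) \<inter> (\<lambda>d. (1 + \<delta>) *\<^sub>R u - d) -` interior (dual_cone C)"
      have "open X" unfolding X_def by (intro open_Int open_vimage continuous_intros) auto
      moreover have "u \<in> X"
      proof -
        have "\<delta> *\<^sub>R u \<in> interior (dual_cone C)" using D.scale_interior_C[OF u \<delta>(1)] .
        then show ?thesis unfolding X_def by (simp add: algebra_simps)
      qed
      ultimately obtain d where d: "d \<in> D" "d \<in> X" using D(2) by blast
      have d1: "d - (1 - \<delta>) *\<^sub>R u \<in> interior (dual_cone C)" and d2: "(1 + \<delta>) *\<^sub>R u - d \<in> interior (dual_cone C)"
        using d(2) by (auto simp: X_def)
      have u1: "(1 - \<delta>) *\<^sub>R u \<in> dual_cone C" using u0(1) \<delta> by (intro D.scale_C) auto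
      have dI: "d \<in> interior (dual_cone C)" using D.add_interior_C[OF d1 u1] by simp
      have close: "\<bar>gap (Kn n) d - gap (Kn n) u\<bar> \<le> e / 3" for n
      proof -
        have "(1 - \<delta>) * gap (Kn n) u \<le> gap (Kn n) d"
          using g(2)[OF u1 D.interior_C_D[OF d1]] g(3)[OF u0(1), of "1 - \<delta>"] \<delta> by simp
        moreover have "gap (Kn n) d \<le> (1 + \<delta>) * gap (Kn n) u"
          using g(2)[OF D.interior_C_D[OF dI] D.interior_C_D[OF d2]] g(3)[OF u0(1), of "1 + \<delta>"] \<delta> by simp
        moreover have "\<delta> * gap (Kn n) u \<le> e / 3"
          using \<delta>e mult_left_mono[OF bnd[OF u, of n], of \<delta>] \<delta> by linarith
        ultimately show ?thesis unfolding left_diff_distrib distrib_right abs_le_iff by linarith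
      qed
      have dS: "d \<in> S" using d(1) dI by (simp add: S_def)
      then obtain l where "(\<lambda>n. gap (Kn (k n)) d / norm d) \<longlonglongrightarrow> l" using k(2) by blast
      then have "(\<lambda>n. gap (Kn (k n)) d / norm d * norm d) \<longlonglongrightarrow> l * norm d" by (intro tendsto_intros)
      moreover have "d \<noteq> 0" using dI by (rule D.interior_nonzero)
      ultimately have "Cauchy (\<lambda>n. gap (Kn (k n)) d)" by (auto intro: LIMSEQ_imp_Cauchy)
      then obtain N where N: "\<And>m n. m \<ge> N \<Longrightarrow> n \<ge> N \<Longrightarrow> dist (gap (Kn (k m)) d) (gap (Kn (k n)) d) < e / 3"
        unfolding Cauchy_def using e by (metis zero_less_divide_iff zero_less_numeral)
      have "dist (gap (Kn (k m)) u) (gap (Kn (k n)) u) < e" if "m \<ge> N" "n \<ge> N" for m n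
        using N[OF that] close[of "k m"] close[of "k n"] unfolding dist_real_def by linarith
      then show "\<exists>N. \<forall>m\<ge>N. \<forall>n\<ge>N. dist (gap (Kn (k m)) u) (gap (Kn (k n)) u) < e" by blast
    qed
    then show ?thesis by (rule Cauchy_convergent)
  qed
  then show ?thesis using that[OF k(1), of "\<lambda>u. lim (\<lambda>n. gap (Kn (k n)) u)"] by (simp add: convergent_LIMSEQ_iff)
qed

text \<open>The Wulff shape of \<open>h\<close>. The linear bound on \<open>h\<close> makes it
  nonempty and positivity at a single \<open>u0\<close> excludes the origin. Only an inequality
  holds for the gap, because \<open>h\<close> need not be the gap function of a convex set.\<close>

lemma wulff_shape:
  fixes h :: "'a \<Rightarrow> real"
  defines "K \<equiv> {x\<in>C. \<forall>u\<in>interior (dual_cone C). h u \<le> - (u \<bullet> x)}"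
  assumes bnd: "\<And>u. u \<in> interior (dual_cone C) \<Longrightarrow> h u \<le> M * norm u"
    and pos: "u0 \<in> interior (dual_cone C)" "h u0 > 0"
  shows "C_pseudo_cone C K" "\<And>u. u \<in> interior (dual_cone C) \<Longrightarrow> h u \<le> gap K u"
proof -
  have eq: "K = C \<inter> (\<Inter>u\<in>interior (dual_cone C). {x. u \<bullet> x \<le> - h u})"
    unfolding K_def by (auto simp: le_minus_iff[of "h _"])
  have cl: "closed K" unfolding eq using closed_C by (auto intro!: closed_INT closed_halfspace_le)
  have cv: "convex K" unfolding eq
    using convex_C by (intro convex_Int convex_INT ballI convex_halfspace_le)
  have ne: "K \<noteq> {}"
  proof -
    obtain a where "a \<in> interior C" using solid by blast
    then obtain c e where ce: "c > 0" "e > 0"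
      "\<And>x' p. dist a x' < e \<Longrightarrow> (\<And>y. y \<in> C \<Longrightarrow> 0 \<le> p \<bullet> y) \<Longrightarrow> c * norm p \<le> p \<bullet> x'" using interior_gap by blast
    \<comment> \<open>With this factor \<open>- (u \<bullet> (t a)) \<ge> t c norm u = \<bar>M\<bar>
      norm u\<close>, which dominates \<open>h u\<close> for all \<open>u\<close> at once.\<close>
    define t where "t = \<bar>M\<bar> / c"
    have "h u \<le> - (u \<bullet> (t *\<^sub>R a))" if "u \<in> interior (dual_cone C)" for u
    proof -
      have "c * norm (- u) \<le> (- u) \<bullet> a" using dual_interior_D[OF that] ce(2)
        by (intro ce(3)) (auto simp: dual_cone_def)
      then have "t * (c * norm u) \<le> t * (- (u \<bullet> a))" using ce by (intro mult_left_mono) (auto simp: t_def)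
      moreover have "t * (c * norm u) = \<bar>M\<bar> * norm u" using ce(1) by (simp add: t_def)
      moreover have "M * norm u \<le> \<bar>M\<bar> * norm u" by (intro mult_right_mono) auto
      ultimately show ?thesis using bnd[OF that] by simp
    qed
    moreover have "t *\<^sub>R a \<in> C" using \<open>a \<in> interior C\<close> interior_C_D ce(1) by (intro scale_C) (auto simp: t_def)
    ultimately have "t *\<^sub>R a \<in> K" by (simp add: K_def)
    then show ?thesis by blast
  qed
  have pl: "x + z \<in> K" if "x \<in> K" "z \<in> C" for x z
  proof -
    have "h u \<le> - (u \<bullet> (x + z))" if "u \<in> interior (dual_cone C)" for u
    proof -
      have "u \<bullet> z \<le> 0" using \<open>z \<in> C\<close> dual_interior_D[OF that] by (auto simp: dual_cone_def)
      then show ?thesis using that \<open>x \<in> K\<close> by (force simp: K_def inner_add_right)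
    qed
    then show ?thesis using that add_C by (auto simp: K_def)
  qed
  have "0 \<notin> K" using pos by (force simp: K_def)
  then show CK: "C_pseudo_cone C K" unfolding C_pseudo_cone_iff using cl cv ne pl by (auto simp: K_def)
  interpret pseudo_cone_in C K by unfold_locales (rule CK)
  show "h u \<le> gap K u" if "u \<in> interior (dual_cone C)" for u
    using that by (intro gap_ge) (auto simp: K_def)
qed

section \<open>Dilates and translates of pseudo-cones\<close>

lemma C_pseudo_cone_scale:
  assumes L: "C_pseudo_cone C L" and t: "t > 0" shows "C_pseudo_cone C ((*\<^sub>R) t ` L)"
proof -
  interpret pseudo_cone_in C L by unfold_locales fact
  have "t *\<^sub>R x + z \<in> (*\<^sub>R) t ` L" if "x \<in> L" "z \<in> C" for x z
  proof -
    have "x + (1/t) *\<^sub>R z \<in> L" using that t by (intro plus_K scale_C) auto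
    then have "t *\<^sub>R (x + (1/t) *\<^sub>R z) \<in> (*\<^sub>R) t ` L" by blast
    then show ?thesis using t by (simp add: scaleR_add_right)
  qed
  then show ?thesis unfolding C_pseudo_cone_iff
    using nonempty_K closed_K convex_K zero_K K_subset_C t scale_C
    by (auto intro!: closed_scaling convex_scaling)
qed

lemma gap_image_scale:
  assumes L: "C_pseudo_cone C L" and u: "u \<in> dual_cone C" and t: "t > 0"
  shows "gap ((*\<^sub>R) t ` L) u = t * gap L u"
proof -
  interpret L: pseudo_cone_in C L by unfold_locales fact
  interpret tL: pseudo_cone_in C "(*\<^sub>R) t ` L" by unfold_locales (rule C_pseudo_cone_scale[OF L t])
  have "t * gap L u \<le> gap ((*\<^sub>R) t ` L) u"
    using mult_left_mono[OF L.gap_le[OF u], of _ t] t by (intro tL.gap_ge) auto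
  moreover have "gap ((*\<^sub>R) t ` L) u / t \<le> gap L u"
    using tL.gap_le[OF u, of "t *\<^sub>R _"] t by (intro L.gap_ge) (simp add: pos_divide_le_eq mult.commute)
  ultimately show ?thesis using t by (simp add: field_simps)
qed

lemma C_pseudo_cone_translate:
  assumes a: "a \<in> interior C" shows "C_pseudo_cone C ((+) a ` C)"
  unfolding C_pseudo_cone_iff
proof (intro conjI ballI)
  show "0 \<notin> (+) a ` C"
  proof
    assume "0 \<in> (+) a ` C"
    then obtain y where "y \<in> C" "0 = a + y" by blast
    then have "- a \<in> C" by (metis add_eq_0_iff)
    then show False using pointed_C[of a] interior_C_D[OF a] interior_nonzero[OF a] by blast
  qed
  show "x + z \<in> (+) a ` C" if "x \<in> (+) a ` C" "z \<in> C" for x z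
    using that add_C by (auto simp: add.assoc)
qed (use a interior_C_D zero_C closed_C convex_C add_C in \<open>auto intro: closed_translation convex_translation\<close>)

end

section \<open>Weighted volume of the complement\<close>

context weighted_cone
begin

lemma emeasure_\<mu>_Int_C: "A \<in> sets borel \<Longrightarrow> emeasure \<mu> (C \<inter> A) = emeasure \<mu> A"
  using closed_C by (subst (1 2) emeasure_\<mu>) (auto intro!: nn_integral_cong simp: weight_def indicator_def)

lemma emeasure_\<mu>_ball: assumes "r > 0" shows "emeasure \<mu> (ball 0 r) = ennreal (r powr \<alpha>) * emeasure \<mu> (ball 0 1)"
proof -
  have "ball 0 r = (*\<^sub>R) r ` ball (0::'a) 1" using assms by (simp add: ball_scale)
  then show ?thesis using emeasure_\<mu>_scale[of "ball 0 1" r] assms by simp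
qed

lemma emeasure_\<mu>_complement_scale:
  assumes L: "C_pseudo_cone C L" and t: "t > 0"
  shows "emeasure \<mu> (C - (*\<^sub>R) t ` L) = ennreal (t powr \<alpha>) * emeasure \<mu> (C - L)"
proof -
  interpret L: pseudo_cone_in C L by unfold_locales fact
  have C: "(*\<^sub>R) t ` C = C"
  proof
    show "C \<subseteq> (*\<^sub>R) t ` C"
    proof
      fix x assume "x \<in> C"
      then have "t *\<^sub>R ((1/t) *\<^sub>R x) \<in> (*\<^sub>R) t ` C" using t by (intro imageI scale_C) auto
      then show "x \<in> (*\<^sub>R) t ` C" using t by simp
    qed
  qed (use t scale_C in auto)
  have "inj ((*\<^sub>R) t :: 'a \<Rightarrow> 'a)" using t by (auto simp: inj_on_def)
  then have "(*\<^sub>R) t ` (C - L) = C - (*\<^sub>R) t ` L" using C by (simp add: image_set_diff)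
  then show ?thesis using emeasure_\<mu>_scale[of "C - L" t] t closed_C L.closed_K by simp
qed

text \<open>Fatou's lemma for indicators: by \<open>ev\<close> the indicator of \<open>C - K\<close>
  is at most the lower limit of those of \<open>C - L n\<close>.\<close>

lemma emeasure_complement_le_liminf:
  assumes K: "closed K" "\<And>n. closed (L n)" and B: "\<And>n. emeasure \<mu> (C - L n) \<le> B"
    and ev: "\<And>x. x \<in> C - K \<Longrightarrow> eventually (\<lambda>n. x \<notin> L n) sequentially"
  shows "emeasure \<mu> (C - K) \<le> B"
proof -
  have bm: "C - K \<in> sets borel" "\<And>n. C - L n \<in> sets borel" using K closed_C by auto
  have "emeasure \<mu> (C - K) = (\<integral>\<^sup>+x. indicator (C - K) x \<partial>\<mu>)" using bm by simp
  also have "\<dots> \<le> (\<integral>\<^sup>+x. liminf (\<lambda>n. indicator (C - L n) x) \<partial>\<mu>)"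
  proof (rule nn_integral_mono)
    fix x show "indicator (C - K) x \<le> liminf (\<lambda>n. indicator (C - L n) x :: ennreal)"
    proof (cases "x \<in> C - K")
      case True
      have "1 \<le> liminf (\<lambda>n. indicator (C - L n) x :: ennreal)"
        using ev[OF True] True by (intro Liminf_bounded) (auto elim!: eventually_mono)
      then show ?thesis using True by simp
    qed simp
  qed
  also have "\<dots> \<le> liminf (\<lambda>n. \<integral>\<^sup>+x. indicator (C - L n) x \<partial>\<mu>)"
    using bm by (intro nn_integral_liminf) auto
  also have "\<dots> \<le> B" using bm B by (intro Liminf_le) auto
  finally show ?thesis .
qed

text \<open>The part of \<open>C\<close> in the ball of radius \<open>gap L u\<close> lies in
  \<open>C - L\<close>, and the mass of that ball scales from the unit ball.\<close>

lemma gap_powr_le: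
  assumes L: "C_pseudo_cone C L" and u: "u \<in> Omega_dual C"
  shows "ennreal (gap L u powr \<alpha>) * emeasure \<mu> (ball 0 1) \<le> emeasure \<mu> (C - L)"
proof -
  interpret L: pseudo_cone_in C L by unfold_locales fact
  note u' = Omega_dual_D[OF u]
  have g: "gap L u > 0" using u' L.gap_pos by blast
  have "emeasure \<mu> (C \<inter> ball 0 (gap L u)) \<le> emeasure \<mu> (C - L)"
    using L.ball_gap_subset[OF dual_interior_D[OF u'(1)]] u'(2) closed_C L.closed_K
    by (intro emeasure_mono) auto
  then show ?thesis using emeasure_\<mu>_ball[OF g] by (simp add: emeasure_\<mu>_Int_C)
qed

end

section \<open>The variational problem\<close>

locale prescribed_measure = weighted_cone C \<Theta> q for C :: "'a::euclidean_space set" and \<Theta> q +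
  fixes \<phi> :: "'a measure"
  assumes sets_\<phi>: "sets \<phi> = sets (restrict_space borel (Omega_dual C))"
    and finite_\<phi>: "finite_measure \<phi>"
    and nonzero_\<phi>: "emeasure \<phi> (Omega_dual C) \<noteq> 0"
begin

sublocale finite_measure \<phi> by (rule finite_\<phi>)

lemma space_\<phi>: "space \<phi> = Omega_dual C"
  using sets_eq_imp_space_eq[OF sets_\<phi>] by (simp add: space_restrict_space)

definition total_mass :: real where "total_mass = measure \<phi> (Omega_dual C)"

lemma total_mass_pos: "total_mass > 0" and emeasure_Omega: "emeasure \<phi> (Omega_dual C) = ennreal total_mass"
  using nonzero_\<phi> by (auto simp: total_mass_def emeasure_eq_measure zero_less_measure_iff)

definition ball_mass :: real where "ball_mass = measure \<mu> (ball 0 1)"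

lemma ball_mass_pos: "ball_mass > 0" and emeasure_unit_ball: "emeasure \<mu> (ball 0 1) = ennreal ball_mass"
  using \<mu>_ball_1 by (auto simp: ball_mass_def measure_def enn2real_positive_iff less_top)

text \<open>The radius of the ball around the origin whose weighted mass is
  \<open>total_mass\<close>.\<close>

definition gap_max :: real where "gap_max = (total_mass / ball_mass) powr (1 / \<alpha>)"

lemma gap_max_pos: "gap_max > 0"
  using total_mass_pos ball_mass_pos by (simp add: gap_max_def)

text \<open>An inequality rather than an equation, since that is what survives passage to the
  limit.\<close>

definition admissible :: "'a set \<Rightarrow> bool" where
  "admissible L \<longleftrightarrow> C_pseudo_cone C L \<and> emeasure \<mu> (C - L) \<le> ennreal total_mass"

text \<open>Maximizing the integral of \<open>ln (gap L u)\<close> becomes minimizing this one. For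
  admissible \<open>L\<close> the integrand is nonnegative by the a priori bound
  \<open>gap_max\<close>, so \<open>ennreal\<close> truncates nothing and Fatou's lemma
  applies.\<close>

definition cost :: "'a set \<Rightarrow> ennreal" where
  "cost L = (\<integral>\<^sup>+u. ennreal (ln gap_max - ln (gap L u)) \<partial>\<phi>)"

definition minimizer :: "'a set \<Rightarrow> bool" where
  "minimizer K \<longleftrightarrow> admissible K \<and> cost K < \<infinity> \<and> (\<forall>L. admissible L \<longrightarrow> cost K \<le> cost L)"

lemma measurable_\<phi>: "f \<in> borel_measurable (restrict_space borel (Omega_dual C)) \<Longrightarrow> f \<in> borel_measurable \<phi>"
  using measurable_cong_sets[OF sets_\<phi> refl] by blast

lemma gap_measurable_\<phi>: "C_pseudo_cone C L \<Longrightarrow> gap L \<in> borel_measurable \<phi>"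
  by (intro measurable_\<phi> pseudo_cone_in.gap_measurable) unfold_locales

lemma gap_le_max: assumes "admissible L" "u \<in> Omega_dual C" shows "gap L u \<le> gap_max"
proof -
  have L: "C_pseudo_cone C L" using assms(1) by (simp add: admissible_def)
  interpret L: pseudo_cone_in C L by unfold_locales fact
  have g: "gap L u > 0" using L.gap_pos Omega_dual_D(1)[OF assms(2)] by blast
  have "ennreal (gap L u powr \<alpha>) * ennreal ball_mass \<le> ennreal total_mass"
    using gap_powr_le[OF L assms(2)] assms(1) unfolding admissible_def emeasure_unit_ball by (meson order_trans)
  then have "gap L u powr \<alpha> * ball_mass \<le> total_mass" using ball_mass_pos total_mass_pos by (simp add: ennreal_mult[symmetric])
  then have "gap L u powr \<alpha> \<le> total_mass / ball_mass" using ball_mass_pos by (simp add: field_simps)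
  then have "(gap L u powr \<alpha>) powr (1 / \<alpha>) \<le> gap_max" unfolding gap_max_def using \<alpha> by (intro powr_mono2) auto
  then show ?thesis using \<alpha> g by (simp add: powr_powr)
qed

lemma gap_le_max_norm:
  assumes L: "admissible L" and u: "u \<in> interior (dual_cone C)" shows "gap L u \<le> gap_max * norm u"
proof -
  have CL: "C_pseudo_cone C L" using L by (simp add: admissible_def)
  interpret L: pseudo_cone_in C L by unfold_locales fact
  have "interior (dual_cone C) \<noteq> {}" using u by blast
  then interpret D: solid_cone "dual_cone C" by (rule solid_cone_dual)
  have nz: "norm u > 0" using D.interior_nonzero[OF u] by simp
  define v where "v = (1 / norm u) *\<^sub>R u"
  have v: "v \<in> Omega_dual C" unfolding Omega_dual_def v_def using nz D.scale_interior_C[OF u, of "1 / norm u"] by simp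
  have "gap L u = norm u * gap L v"
    using L.gap_scale[of v "norm u"] nz v Omega_dual_D dual_interior_D by (simp add: v_def)
  then show ?thesis using gap_le_max[OF L v] nz by (simp add: mult.commute)
qed

text \<open>A suitable dilate of \<open>a + C\<close>: as \<open>a\<close> is an interior point, its
  gap is bounded below by a positive constant on all of \<open>Omega_dual C\<close>, and \<phi> is
  finite.\<close>

lemma admissible_exists: "\<exists>L. admissible L \<and> cost L < \<infinity>"
proof -
  obtain a where a: "a \<in> interior C" using solid by blast
  define L where "L = (+) a ` C"
  have L: "C_pseudo_cone C L" unfolding L_def by (rule C_pseudo_cone_translate[OF a])
  have fin: "emeasure \<mu> (C - L) < \<infinity>" by (rule \<mu>_complement_finite[OF L])
  define V where "V = measure \<mu> (C - L)"
  have V: "emeasure \<mu> (C - L) = ennreal V" "V \<ge> 0" using fin by (auto simp: V_def emeasure_eq_ennreal_measure)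
  \<comment> \<open>The volume scales by \<open>t powr \<alpha> = total_mass / (V + 1)\<close>; the
    summand 1 avoids a separate case \<open>V = 0\<close>.\<close>
  define t where "t = (total_mass / (V + 1)) powr (1 / \<alpha>)"
  have t: "t > 0" using total_mass_pos V by (simp add: t_def)
  have "t powr \<alpha> = total_mass / (V + 1)" using \<alpha> total_mass_pos V by (simp add: t_def powr_powr)
  then have "t powr \<alpha> * V = total_mass * (V / (V + 1))" by simp
  also have "\<dots> \<le> total_mass * 1" using total_mass_pos V by (intro mult_left_mono) auto
  finally have "t powr \<alpha> * V \<le> total_mass" by simp
  then have adm: "admissible ((*\<^sub>R) t ` L)" unfolding admissible_def
    using C_pseudo_cone_scale[OF L t] emeasure_\<mu>_complement_scale[OF L t] V
    by (simp add: ennreal_mult'[symmetric] ennreal_leI)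
  obtain c e where ce: "c > 0" "e > 0"
      "\<And>x' p. dist a x' < e \<Longrightarrow> (\<And>y. y \<in> C \<Longrightarrow> 0 \<le> p \<bullet> y) \<Longrightarrow> c * norm p \<le> p \<bullet> x'" using interior_gap a by blast
  interpret L: pseudo_cone_in C L by unfold_locales fact
  have "cost ((*\<^sub>R) t ` L) \<le> (\<integral>\<^sup>+u. ennreal (ln gap_max - ln (t * c)) \<partial>\<phi>)"
    unfolding cost_def
  proof (intro nn_integral_mono ennreal_leI diff_left_mono)
    fix u assume "u \<in> space \<phi>"
    then have u: "u \<in> dual_cone C" "norm u = 1" using Omega_dual_D dual_interior_D by (auto simp: space_\<phi>)
    have "c \<le> gap L u"
    proof (rule L.gap_ge)
      fix x assume "x \<in> L"
      then obtain y where y: "y \<in> C" "x = a + y" by (auto simp: L_def)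
      have "c * norm (- u) \<le> (- u) \<bullet> a" using u ce(2) by (intro ce(3)) (auto simp: dual_cone_def)
      moreover have "u \<bullet> y \<le> 0" using u y by (auto simp: dual_cone_def)
      ultimately show "c \<le> - (u \<bullet> x)" using u y by (simp add: inner_add_right)
    qed
    then show "ln (t * c) \<le> ln (gap ((*\<^sub>R) t ` L) u)"
      using gap_image_scale[OF L u(1) t] t ce(1) by simp
  qed
  also have "\<dots> < \<infinity>"
    by (simp add: space_\<phi> emeasure_Omega ennreal_mult_less_top)
  finally show ?thesis using adm by blast
qed

text \<open>Direct method: the gaps of a minimizing sequence converge along a subsequence to some
  \<open>h\<close>, and the Wulff shape of \<open>h\<close> is the minimizer. Fatou's lemma is used
  twice, for the cost and for the volume constraint.\<close>

lemma minimizer_exists: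
  obtains K where "minimizer K"
proof -
  obtain L0 where L0: "admissible L0" "cost L0 < \<infinity>" using admissible_exists by blast
  then have "cost ` Collect admissible \<noteq> {}" by blast
  from Inf_as_limit[OF this] obtain v where v: "\<forall>n. v n \<in> cost ` Collect admissible" "v \<longlonglongrightarrow> Inf (cost ` Collect admissible)"
    by (elim exE conjE)
  have "\<forall>n. \<exists>L. admissible L \<and> cost L = v n"
  proof
    fix n show "\<exists>L. admissible L \<and> cost L = v n" using v(1)[rule_format, of n] by (elim imageE) auto
  qed
  then obtain Kn where "\<forall>n. admissible (Kn n) \<and> cost (Kn n) = v n" by (rule choice[THEN exE])
  then have Kn: "admissible (Kn n)" "cost (Kn n) = v n" for n by blast+
  define I where "I = Inf (cost ` Collect admissible)"
  have I: "\<And>L. admissible L \<Longrightarrow> I \<le> cost L" unfolding I_def by (auto intro: INF_lower)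
  then have Ifin: "I < \<infinity>" using L0 by (meson order.strict_trans1)
  have pc: "C_pseudo_cone C (Kn n)" for n using Kn by (simp add: admissible_def)
  have pc': "pseudo_cone_in C (Kn n)" for n by unfold_locales (rule pc)
  obtain k h where k: "strict_mono (k::nat\<Rightarrow>nat)"
    and h: "\<And>u. u \<in> interior (dual_cone C) \<Longrightarrow> (\<lambda>n. gap (Kn (k n)) u) \<longlonglongrightarrow> h u"
    by (rule gap_convergent_subsequence[of Kn gap_max, OF pc gap_le_max_norm[OF Kn(1)]]) (assumption, rule that)
  have hM: "h u \<le> gap_max * norm u" if "u \<in> interior (dual_cone C)" for u
    using gap_le_max_norm[OF Kn(1) that] by (intro tendsto_upperbound[OF h[OF that]]) auto
  have h0: "h u \<ge> 0" if "u \<in> interior (dual_cone C)" for u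
    using pseudo_cone_in.gap_nonneg[OF pc' dual_interior_D[OF that]] by (intro tendsto_lowerbound[OF h[OF that]]) auto
  \<comment> \<open>The limit \<open>h\<close> may vanish somewhere; the integrand has to be
    infinite there.\<close>
  define E where "E u = (if h u = 0 then \<infinity> else ennreal (ln gap_max - ln (h u)))" for u
  have E: "E u \<le> liminf (\<lambda>n. ennreal (ln gap_max - ln (gap (Kn (k n)) u)))" if "u \<in> Omega_dual C" for u
    unfolding E_def using that Omega_dual_D
    by (intro liminf_log pseudo_cone_in.gap_pos[OF pc'] h) auto
  have "(\<integral>\<^sup>+u. E u \<partial>\<phi>) \<le> (\<integral>\<^sup>+u. liminf (\<lambda>n. ennreal (ln gap_max - ln (gap (Kn (k n)) u))) \<partial>\<phi>)"
    by (intro nn_integral_mono E) (simp add: space_\<phi>)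
  also have "\<dots> \<le> liminf (\<lambda>n. cost (Kn (k n)))" unfolding cost_def
    using gap_measurable_\<phi>[OF pc] by (intro nn_integral_liminf) measurable
  also have "\<dots> = I"
  proof -
    have "(v \<circ> k) \<longlonglongrightarrow> I" unfolding I_def by (rule LIMSEQ_subseq_LIMSEQ[OF v(2) k])
    then have "liminf (v \<circ> k) = I" by (intro lim_imp_Liminf) auto
    then show ?thesis by (simp add: Kn(2) o_def)
  qed
  finally have EI: "(\<integral>\<^sup>+u. E u \<partial>\<phi>) \<le> I" .
  \<comment> \<open>If \<open>h\<close> vanished on all of \<open>Omega_dual C\<close>, the limit
    cost would be infinite because \<phi> is nonzero. This keeps the origin out of the Wulff
    shape.\<close>
  have "\<exists>u0 \<in> Omega_dual C. h u0 > 0"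
  proof (rule ccontr)
    assume "\<not> ?thesis"
    then have "E u = \<infinity>" if "u \<in> Omega_dual C" for u
      using that h0[OF Omega_dual_D(1)[OF that]] by (auto simp: E_def not_less dest!: bspec[OF _ that])
    then have "(\<integral>\<^sup>+u. E u \<partial>\<phi>) = (\<integral>\<^sup>+u. \<infinity> \<partial>\<phi>)" by (intro nn_integral_cong) (simp add: space_\<phi>)
    also have "\<dots> = \<infinity>" using total_mass_pos by (simp add: space_\<phi> emeasure_Omega ennreal_top_mult)
    finally show False using EI Ifin by simp
  qed
  then obtain u0 where u0: "u0 \<in> Omega_dual C" "h u0 > 0" by blast
  define K where "K = {x\<in>C. \<forall>u\<in>interior (dual_cone C). h u \<le> - (u \<bullet> x)}"
  note wulff = wulff_shape[of h gap_max u0, OF hM Omega_dual_D(1)[OF u0(1)] u0(2), folded K_def]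
  have CK: "C_pseudo_cone C K" and Kh: "\<And>u. u \<in> interior (dual_cone C) \<Longrightarrow> h u \<le> gap K u"
    by (rule wulff(1), assumption) (rule wulff(2))
  interpret K: pseudo_cone_in C K by unfold_locales (rule CK)
  have "emeasure \<mu> (C - K) \<le> ennreal total_mass"
  proof (rule emeasure_complement_le_liminf[OF K.closed_K])
    show "closed (Kn (k n))" for n using pseudo_cone_in.closed_K[OF pc'] .
    show "emeasure \<mu> (C - Kn (k n)) \<le> ennreal total_mass" for n using Kn(1) by (simp add: admissible_def)
    fix x assume "x \<in> C - K"
    \<comment> \<open>A point outside \<open>K\<close> violates some constraint strictly, hence also
      the corresponding one for \<open>Kn (k n)\<close> with \<open>n\<close> large.\<close>
    then obtain u where u: "u \<in> interior (dual_cone C)" "- (u \<bullet> x) < h u" by (auto simp: K_def not_le)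
    have "eventually (\<lambda>n. - (u \<bullet> x) < gap (Kn (k n)) u) sequentially"
      using order_tendstoD(1)[OF h[OF u(1)] u(2)] .
    then show "eventually (\<lambda>n. x \<notin> Kn (k n)) sequentially"
      using pseudo_cone_in.gap_le[OF pc' dual_interior_D[OF u(1)]]
      by (auto elim!: eventually_mono simp: not_le[symmetric])
  qed
  then have "admissible K" using CK by (simp add: admissible_def)
  moreover have "cost K \<le> I"
  proof -
    have "cost K \<le> (\<integral>\<^sup>+u. E u \<partial>\<phi>)" unfolding cost_def
    proof (rule nn_integral_mono)
      fix u assume "u \<in> space \<phi>"
      then have u: "u \<in> interior (dual_cone C)" using Omega_dual_D by (simp add: space_\<phi>)
      have "ln (h u) \<le> ln (gap K u)" if "h u \<noteq> 0" using that h0[OF u] Kh[OF u] by simp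
      then show "ennreal (ln gap_max - ln (gap K u)) \<le> E u" by (auto simp: E_def intro!: ennreal_leI)
    qed
    then show ?thesis using EI by simp
  qed
  moreover have "cost K \<le> cost L" if "admissible L" for L using \<open>cost K \<le> I\<close> I[OF that] by (rule order_trans)
  moreover have "cost K < \<infinity>" using \<open>cost K \<le> I\<close> Ifin by (rule order.strict_trans1)
  ultimately show ?thesis using that unfolding minimizer_def by blast
qed

text \<open>The cost of \<open>K\<close> is finite, so the pointwise comparison integrates over the
  reals to \<open>cost K \<le> cost L \<le> cost K - a total_mass - b \<phi>(F)\<close>.\<close>

lemma minimizer_variation:
  assumes min: "minimizer K"
    and L: "admissible L" and F: "F \<in> sets \<phi>"
    and le: "\<And>u. u \<in> Omega_dual C \<Longrightarrow> ln (gap K u) + a + b * indicator F u \<le> ln (gap L u)"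
  shows "a * total_mass + b * measure \<phi> F \<le> 0"
proof -
  have K: "admissible K" "cost K < \<infinity>" "cost K \<le> cost L" using min L by (auto simp: minimizer_def)
  have CK: "C_pseudo_cone C K" and CL: "C_pseudo_cone C L" using K L by (auto simp: admissible_def)
  have pK: "pseudo_cone_in C K" and pL: "pseudo_cone_in C L" by (unfold_locales; fact)+
  define f where "f u = ln gap_max - ln (gap K u)" for u
  have f0: "f u \<ge> 0" if "u \<in> Omega_dual C" for u
    using gap_le_max[OF K(1) that] pseudo_cone_in.gap_pos[OF pK, of u] Omega_dual_D[OF that] gap_max_pos by (simp add: f_def)
  have f_meas: "f \<in> borel_measurable \<phi>" unfolding f_def using gap_measurable_\<phi>[OF CK] by measurable
  have JK: "cost K = (\<integral>\<^sup>+u. ennreal (f u) \<partial>\<phi>)" by (simp add: cost_def f_def)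
  have int_f: "integrable \<phi> f"
    using K(2) f0 by (intro integrableI_nonneg f_meas) (auto simp: JK space_\<phi>)
  define g where "g u = f u - a - b * indicator F u" for u
  have int_F: "integrable \<phi> (indicator F :: _ \<Rightarrow> real)"
    using emeasure_finite[of F] by (intro integrable_real_indicator F) (auto simp: less_top[symmetric])
  have int_g: "integrable \<phi> g" unfolding g_def using int_f int_F by simp
  have gL: "ln gap_max - ln (gap L u) \<le> g u" if "u \<in> Omega_dual C" for u using le[OF that] by (simp add: g_def f_def)
  \<comment> \<open>Needed to pass from \<open>ennreal\<close> integrals back to real ones; it
    follows from the bound \<open>gap_max\<close> for \<open>L\<close>.\<close>
  have g0: "g u \<ge> 0" if "u \<in> Omega_dual C" for u
  proof -
    have "ln (gap L u) \<le> ln gap_max"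
      using gap_le_max[OF L that] pseudo_cone_in.gap_pos[OF pL, of u] Omega_dual_D[OF that] gap_max_pos by simp
    then show ?thesis using gL[OF that] by simp
  qed
  have "ennreal (\<integral>u. f u \<partial>\<phi>) = cost K" unfolding JK
    using f0 by (intro nn_integral_eq_integral[symmetric] int_f) (auto simp: space_\<phi>)
  also have "\<dots> \<le> cost L" by (rule K(3))
  also have "\<dots> \<le> (\<integral>\<^sup>+u. ennreal (g u) \<partial>\<phi>)" unfolding cost_def
    using gL by (intro nn_integral_mono ennreal_leI) (auto simp: space_\<phi>)
  also have "\<dots> = ennreal (\<integral>u. g u \<partial>\<phi>)"
    using g0 by (intro nn_integral_eq_integral int_g) (auto simp: space_\<phi>)
  finally have "(\<integral>u. f u \<partial>\<phi>) \<le> (\<integral>u. g u \<partial>\<phi>)"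
    using g0 by (subst (asm) ennreal_le_iff) (auto intro!: integral_nonneg_AE simp: space_\<phi>)
  also have "(\<integral>u. g u \<partial>\<phi>) = (\<integral>u. f u \<partial>\<phi>) - a * total_mass - b * measure \<phi> F"
  proof -
    have "(\<integral>u. g u \<partial>\<phi>) = (\<integral>u. f u \<partial>\<phi>) - (\<integral>u. a \<partial>\<phi>) - (\<integral>u. b * indicator F u \<partial>\<phi>)"
    proof -
      have "(\<integral>u. f u - a \<partial>\<phi>) = (\<integral>u. f u \<partial>\<phi>) - (\<integral>u. a \<partial>\<phi>)"
        by (rule Bochner_Integration.integral_diff[OF int_f integrable_const])
      moreover have "(\<integral>u. g u \<partial>\<phi>) = (\<integral>u. f u - a \<partial>\<phi>) - (\<integral>u. b * indicator F u \<partial>\<phi>)"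
        unfolding g_def
        by (rule Bochner_Integration.integral_diff[OF Bochner_Integration.integrable_diff[OF int_f integrable_const] integrable_mult_right[OF int_F]])
      ultimately show ?thesis by simp
    qed
    moreover have "F \<inter> space \<phi> = F" using sets.sets_into_space[OF F] by blast
    ultimately show ?thesis by (simp only: lebesgue_integral_const integral_mult_right_zero
        Bochner_Integration.integral_indicator total_mass_def space_\<phi> real_scaleR_def mult.commute[of a])
  qed
  finally show ?thesis by simp
qed

text \<open>Removes the volume constraint: a dilate of \<open>L\<close> is admissible, and dilating
  by \<open>t\<close> adds the constant \<open>ln t\<close> to the logarithm of the gap.\<close>

lemma minimizer_log_variation:
  assumes min: "minimizer K"
    and L: "C_pseudo_cone C L" and F: "F \<in> sets \<phi>"
    and le: "\<And>u. u \<in> Omega_dual C \<Longrightarrow> ln (gap K u) + b * indicator F u \<le> ln (gap L u)"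
  shows "b * measure \<phi> F \<le> total_mass / \<alpha> * ln (measure \<mu> (C - L) / total_mass)" "0 < measure \<mu> (C - L)"
proof -
  interpret L: pseudo_cone_in C L by unfold_locales fact
  define V where "V = measure \<mu> (C - L)"
  have V: "emeasure \<mu> (C - L) = ennreal V" using \<mu>_complement_finite[OF L] by (auto simp: V_def emeasure_eq_ennreal_measure)
  have "Omega_dual C \<noteq> {}" using nonzero_\<phi> by auto
  then obtain u where u: "u \<in> Omega_dual C" by blast
  have gp: "gap L u > 0" using L.gap_pos Omega_dual_D[OF u] by blast
  have "0 < ennreal (gap L u powr \<alpha>) * ennreal ball_mass" using gp ball_mass_pos by (simp add: ennreal_mult[symmetric])
  also have "\<dots> \<le> ennreal V" using gap_powr_le[OF L u] by (simp add: V emeasure_unit_ball)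
  finally have Vp: "V > 0" by simp
  then show "0 < measure \<mu> (C - L)" by (simp add: V_def)
  \<comment> \<open>Chosen so that the dilate has complement of volume exactly
    \<open>total_mass\<close>.\<close>
  define t where "t = (total_mass / V) powr (1 / \<alpha>)"
  have t: "t > 0" using total_mass_pos Vp by (simp add: t_def)
  have "t powr \<alpha> * V = total_mass" using \<alpha> total_mass_pos Vp by (simp add: t_def powr_powr)
  then have "admissible ((*\<^sub>R) t ` L)" unfolding admissible_def
    using C_pseudo_cone_scale[OF L t] emeasure_\<mu>_complement_scale[OF L t] V Vp
    by (simp add: ennreal_mult'[symmetric])
  then have "ln t * total_mass + b * measure \<phi> F \<le> 0"
  proof (rule minimizer_variation[OF min _ F])
    fix u assume u: "u \<in> Omega_dual C"
    have "ln (gap ((*\<^sub>R) t ` L) u) = ln t + ln (gap L u)"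
      using gap_image_scale[OF L _ t, of u] t L.gap_pos[of u] Omega_dual_D[OF u] dual_interior_D[of u] by (simp add: ln_mult)
    then show "ln (gap K u) + ln t + b * indicator F u \<le> ln (gap ((*\<^sub>R) t ` L) u)" using le[OF u] by simp
  qed
  moreover have "ln t = (1 / \<alpha>) * ln (total_mass / V)" unfolding t_def by (rule ln_powr)
  moreover have "ln (total_mass / V) = - ln (V / total_mass)" using total_mass_pos Vp by (simp add: ln_div)
  ultimately show "b * measure \<phi> F \<le> total_mass / \<alpha> * ln (measure \<mu> (C - L) / total_mass)"
    unfolding V_def[symmetric] by (simp add: mult.commute[of total_mass])
qed

text \<open>Comparing \<open>K\<close> with its own rescaled copy (\<open>F = {}\<close>,
  \<open>b = 0\<close>) excludes a volume below \<open>total_mass\<close>.\<close>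

lemma minimizer_volume:
  assumes min: "minimizer K"
  shows "emeasure \<mu> (C - K) = ennreal total_mass"
proof -
  have CK: "C_pseudo_cone C K" using min by (simp add: minimizer_def admissible_def)
  have "0 * measure \<phi> {} \<le> total_mass / \<alpha> * ln (measure \<mu> (C - K) / total_mass)" and V: "0 < measure \<mu> (C - K)"
    using minimizer_log_variation[OF min CK, of "{}" 0] by auto
  then have "0 \<le> ln (measure \<mu> (C - K) / total_mass)" using total_mass_pos \<alpha> by (simp add: zero_le_mult_iff zero_le_divide_iff)
  then have "total_mass \<le> measure \<mu> (C - K)" using total_mass_pos V by (simp add: ln_ge_zero_iff)
  moreover have "emeasure \<mu> (C - K) = ennreal (measure \<mu> (C - K))"
    using \<mu>_complement_finite[OF CK] by (simp add: emeasure_eq_ennreal_measure)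
  ultimately show ?thesis using min unfolding minimizer_def admissible_def by (simp add: antisym ennreal_leI)
qed

end

section \<open>Points of contact with supporting hyperplanes\<close>

context pseudo_cone_in
begin

text \<open>A supporting hyperplane with unit normal \<^term>\<open>u\<close> is recorded by the vector \<^term>\<open>p\<close> with
  \<open>p = - u / gap K u\<close>. Contact is a property of rays: it refers to the boundary point on the ray through \<^term>\<open>x\<close>.\<close>

definition polar :: "'a set" where "polar = {p. \<forall>y\<in>K. 1 \<le> p \<bullet> y}"

definition contact :: "'a \<Rightarrow> 'a \<Rightarrow> bool" where
  "contact x p \<longleftrightarrow> p \<in> polar \<and> (\<exists>r>0. r *\<^sub>R x \<in> K \<and> p \<bullet> (r *\<^sub>R x) = 1)"

definition touch :: "'a set \<Rightarrow> 'a set" where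
  "touch Q = {x \<in> interior C. \<exists>p\<in>Q. contact x p}"

text \<open>A relaxation of \<open>touch Q\<close> with slack \<open>s\<close>: an open union of
  rays that decreases into \<open>touch Q\<close> as \<open>s\<close> tends to 0 when
  \<open>Q\<close> is closed.\<close>

definition near :: "real \<Rightarrow> 'a set \<Rightarrow> 'a set" where
  "near s Q = {x \<in> interior C. \<exists>p\<in>polar \<inter> Q. \<exists>r>0. r *\<^sub>R x \<in> K \<and> p \<bullet> (r *\<^sub>R x) < 1 + s}"

text \<open>The variation of \<open>K\<close>: halfspaces \<open>1 \<le> p \<bullet> x\<close> with
  \<open>p \<in> Q\<close> recede from the origin by the factor \<open>1 + s\<close>.\<close>

definition shrink :: "real \<Rightarrow> 'a set \<Rightarrow> 'a set" where
  "shrink s Q = {x \<in> K. \<forall>p\<in>polar \<inter> Q. 1 + s \<le> p \<bullet> x}"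

text \<open>Otherwise moving from a point of \<open>K\<close> along \<open>y\<close>, which never
  leaves \<open>K\<close>, would bring the value of \<open>p\<close> down to 0.\<close>

lemma polar_dual: assumes "p \<in> polar" "y \<in> C" shows "0 \<le> p \<bullet> y"
proof (rule ccontr)
  assume neg: "\<not> 0 \<le> p \<bullet> y"
  obtain x where x: "x \<in> K" using nonempty_K by blast
  have px: "1 \<le> p \<bullet> x" using assms(1) x by (simp add: polar_def)
  define t where "t = (p \<bullet> x) / - (p \<bullet> y)"
  have "t \<ge> 0" using neg px by (auto simp: t_def intro!: divide_nonneg_neg)
  then have "x + t *\<^sub>R y \<in> K" using x assms(2) by (intro plus_K scale_C)
  then have "1 \<le> p \<bullet> (x + t *\<^sub>R y)" using assms(1) by (simp add: polar_def)
  moreover have "t * (p \<bullet> y) = - (p \<bullet> x)" using neg by (simp add: t_def)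
  ultimately show False by (simp add: inner_add_right)
qed

text \<open>Almost-contact vectors subconverge to a contact vector. With slack 0 this makes
  \<open>touch Q\<close> relatively closed in \<open>interior C\<close>; with slack tending to 0 it
  identifies the limit of the sets \<open>near s Q\<close>.\<close>

lemma contact_limit:
  assumes x: "x \<in> interior C" "xs \<longlonglongrightarrow> x" and Q: "closed Q"
    and ps: "\<And>n. ps n \<in> polar \<inter> Q" and rs: "\<And>n. rs n > 0" "\<And>n. rs n *\<^sub>R xs n \<in> K"
    and le: "\<And>n. ps n \<bullet> (rs n *\<^sub>R xs n) \<le> 1 + s n" and s: "s \<longlonglongrightarrow> 0"
  shows "\<exists>p\<in>Q. contact x p"
proof -
  obtain c e where ce: "c > 0" "e > 0"
    "\<And>x' p. dist x x' < e \<Longrightarrow> (\<And>y. y \<in> C \<Longrightarrow> 0 \<le> p \<bullet> y) \<Longrightarrow> c * norm p \<le> p \<bullet> x'" using interior_gap x(1) by blast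
  obtain d where d: "d > 0" "\<And>x. x \<in> K \<Longrightarrow> d \<le> norm x" using dist_zero_K by blast
  obtain y0 where y0: "y0 \<in> K" using nonempty_K by blast
  define R where "R = norm x + e"
  have R: "R > 0" using ce by (simp add: R_def add_nonneg_pos)
  have "eventually (\<lambda>n. dist (xs n) x < e) sequentially" using tendstoD[OF x(2) ce(2)] .
  moreover have "eventually (\<lambda>n. s n < 1) sequentially" using order_tendstoD(2)[OF s] by simp
  ultimately have "eventually (\<lambda>n. dist (xs n) x < e \<and> s n < 1) sequentially" by (rule eventually_conj)
  then obtain N where N: "\<And>n. n \<ge> N \<Longrightarrow> dist (xs n) x < e \<and> s n < 1" by (auto simp: eventually_sequentially)
  \<comment> \<open>Since \<open>x\<close> is interior, \<open>rs n * norm (ps n)\<close> is bounded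
    by \<open>2 / c\<close>. The distance of \<open>K\<close> from the origin bounds
    \<open>rs n\<close> below, hence \<open>ps n\<close> above;
    \<open>1 \<le> ps n \<bullet> y0\<close> bounds \<open>ps n\<close> below, hence
    \<open>rs n\<close> above.\<close>
  have bounds: "norm (ps n) \<le> 2 * R / (c * d) \<and> rs n \<le> 2 * norm y0 / c" if n: "n \<ge> N" for n
  proof -
    have pd: "ps n \<in> polar" using ps by blast
    have c1: "c * norm (ps n) \<le> ps n \<bullet> xs n" using N[OF n] polar_dual[OF pd] by (intro ce(3)) (auto simp: dist_commute)
    have r2: "rs n * (ps n \<bullet> xs n) \<le> 2" using le[of n] N[OF n] by simp
    have r3: "rs n * (c * norm (ps n)) \<le> 2" using mult_left_mono[OF c1, of "rs n"] rs(1)[of n] r2 by linarith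
    have nx: "norm (xs n) \<le> R"
      using N[OF n] norm_triangle_ineq[of "xs n - x" x] by (simp add: R_def dist_norm)
    have "d \<le> rs n * norm (xs n)" using d(2)[OF rs(2)[of n]] rs(1)[of n] by simp
    also have "\<dots> \<le> rs n * R" using nx rs(1)[of n] by simp
    finally have rd: "d \<le> rs n * R" .
    have "d * (c * norm (ps n)) \<le> (rs n * R) * (c * norm (ps n))" using rd ce(1) by (intro mult_right_mono) auto
    also have "\<dots> \<le> 2 * R" using mult_right_mono[OF r3, of R] R by (simp add: mult_ac)
    finally have 1: "norm (ps n) \<le> 2 * R / (c * d)" using ce(1) d(1) by (simp add: field_simps)
    have "1 \<le> ps n \<bullet> y0" using pd y0 by (simp add: polar_def)
    also have "\<dots> \<le> norm (ps n) * norm y0" by (rule norm_cauchy_schwarz)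
    finally have "rs n * c * 1 \<le> rs n * c * (norm (ps n) * norm y0)"
      using rs(1)[of n] ce(1) by (intro mult_left_mono) auto
    also have "\<dots> \<le> 2 * norm y0" using mult_right_mono[OF r3, of "norm y0"] by (simp add: mult_ac)
    finally have "rs n \<le> 2 * norm y0 / c" using ce(1) by (simp add: field_simps)
    then show ?thesis using 1 by blast
  qed
  define S where "S = cball (0::'a) (2 * R / (c * d)) \<times> {0..2 * norm y0 / c}"
  have "compact S" unfolding S_def by (intro compact_Times) auto
  moreover have "(ps (n + N), rs (n + N)) \<in> S" for n
    using bounds[of "n + N"] rs(1)[of "n + N"] by (auto simp: S_def)
  ultimately obtain pr \<sigma> where \<sigma>: "strict_mono (\<sigma>::nat\<Rightarrow>nat)" "((\<lambda>n. (ps (n + N), rs (n + N))) \<circ> \<sigma>) \<longlonglongrightarrow> pr"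
    unfolding compact_def by meson
  define \<tau> where "\<tau> n = \<sigma> n + N" for n
  obtain p r where pr: "pr = (p, r)" by fastforce
  have p: "(\<lambda>n. ps (\<tau> n)) \<longlonglongrightarrow> p" and r: "(\<lambda>n. rs (\<tau> n)) \<longlonglongrightarrow> r"
    using tendsto_fst[OF \<sigma>(2)] tendsto_snd[OF \<sigma>(2)] by (auto simp: o_def \<tau>_def pr)
  have mono: "strict_mono \<tau>" using \<sigma>(1) by (auto simp: \<tau>_def strict_mono_def)
  have xt: "(\<lambda>n. xs (\<tau> n)) \<longlonglongrightarrow> x" and st: "(\<lambda>n. s (\<tau> n)) \<longlonglongrightarrow> 0"
    using LIMSEQ_subseq_LIMSEQ[OF x(2) mono] LIMSEQ_subseq_LIMSEQ[OF s mono] by (auto simp: o_def)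
  have pQ: "p \<in> Q" using closed_sequentially[OF Q _ p] ps by blast
  have pP: "p \<in> polar" unfolding polar_def
  proof safe
    fix y assume "y \<in> K"
    then have "1 \<le> ps (\<tau> n) \<bullet> y" for n using ps[of "\<tau> n"] unfolding polar_def by blast
    moreover have "(\<lambda>n. ps (\<tau> n) \<bullet> y) \<longlonglongrightarrow> p \<bullet> y" using p by (intro tendsto_intros)
    ultimately show "1 \<le> p \<bullet> y" by (intro tendsto_lowerbound[of _ "p \<bullet> y"]) auto
  qed
  have rx: "(\<lambda>n. rs (\<tau> n) *\<^sub>R xs (\<tau> n)) \<longlonglongrightarrow> r *\<^sub>R x" using r xt by (intro tendsto_intros)
  then have rK: "r *\<^sub>R x \<in> K" using closed_sequentially[OF closed_K _ rx] rs(2) by blast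
  have "r \<ge> 0" using rs(1) by (intro tendsto_lowerbound[OF r] always_eventually allI less_imp_le) auto
  then have r0: "r > 0" using rK zero_K by (metis order_le_less scaleR_zero_left)
  have "(\<lambda>n. ps (\<tau> n) \<bullet> (rs (\<tau> n) *\<^sub>R xs (\<tau> n))) \<longlonglongrightarrow> p \<bullet> (r *\<^sub>R x)" by (rule tendsto_inner[OF p rx])
  moreover have "(\<lambda>n. 1 + s (\<tau> n)) \<longlonglongrightarrow> 1 + 0" using st by (intro tendsto_intros)
  ultimately have "p \<bullet> (r *\<^sub>R x) \<le> 1 + 0" using le by (intro LIMSEQ_le) auto
  moreover have "1 \<le> p \<bullet> (r *\<^sub>R x)" using pP rK unfolding polar_def by blast
  ultimately have "p \<bullet> (r *\<^sub>R x) = 1" by simp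
  then show ?thesis using pQ pP r0 rK unfolding contact_def by blast
qed

lemma touch_borel: assumes "closed Q" shows "touch Q \<in> sets borel"
proof -
  have "interior C \<inter> closure (touch Q) \<subseteq> touch Q"
  proof
    fix x assume x: "x \<in> interior C \<inter> closure (touch Q)"
    then have "x \<in> closure (touch Q)" by blast
    then obtain xs where xs: "\<forall>n. xs n \<in> touch Q" "xs \<longlonglongrightarrow> x" unfolding closure_sequential by blast
    from xs(1) have "\<forall>n. \<exists>p r. p \<in> polar \<inter> Q \<and> r > 0 \<and> r *\<^sub>R xs n \<in> K \<and> p \<bullet> (r *\<^sub>R xs n) = 1"
      unfolding touch_def contact_def by blast
    then obtain ps rs where "\<And>n. ps n \<in> polar \<inter> Q" "\<And>n. rs n > (0::real)" "\<And>n. rs n *\<^sub>R xs n \<in> K"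
      "\<And>n. ps n \<bullet> (rs n *\<^sub>R xs n) = 1" by metis
    then have "\<exists>p\<in>Q. contact x p"
      using x by (intro contact_limit[OF _ xs(2) assms, of ps rs "\<lambda>_. 0"]) auto
    then show "x \<in> touch Q" using x by (simp add: touch_def)
  qed
  moreover have "touch Q \<subseteq> interior C" by (auto simp: touch_def)
  then have "touch Q \<subseteq> interior C \<inter> closure (touch Q)" using closure_subset[of "touch Q"] by blast
  ultimately have "touch Q = interior C \<inter> closure (touch Q)" by blast
  then show ?thesis by (metis borel_closed borel_open closed_closure open_interior sets.Int)
qed

text \<open>The set is open: the strict inequality leaves room to push the point of \<open>K\<close>
  further along its ray into \<open>interior K\<close>.\<close>

lemma near_borel: "near s Q \<in> sets borel"
proof -
  have "near s Q = (\<Union>p\<in>polar \<inter> Q. \<Union>r\<in>{0<..}. interior C \<inter> ((\<lambda>x. r *\<^sub>R x) -` interior K \<inter> {x. p \<bullet> (r *\<^sub>R x) < 1 + s}))"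
    (is "_ = ?U")
  proof
    show "near s Q \<subseteq> ?U"
    proof
      fix x assume "x \<in> near s Q"
      then obtain p r where x: "x \<in> interior C" and p: "p \<in> polar \<inter> Q" and r: "r > 0" "r *\<^sub>R x \<in> K"
        and lt: "p \<bullet> (r *\<^sub>R x) < 1 + s" by (auto simp: near_def)
      define a where "a = p \<bullet> (r *\<^sub>R x)"
      have a: "1 \<le> a" "a < 1 + s" using p r(2) lt by (auto simp: polar_def a_def)
      \<comment> \<open>Then \<open>t * a\<close> is the midpoint of \<open>a\<close> and
        \<open>1 + s\<close>.\<close>
      define t where "t = 1 + (1 + s - a) / (2 * a)"
      have t: "t > 1" using a by (simp add: t_def)
      have "t * a = (1 + s + a) / 2" using a by (simp add: t_def field_simps)
      then have "t * a < 1 + s" using a by simp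
      moreover have "p \<bullet> ((t * r) *\<^sub>R x) = t * a" by (simp add: a_def)
      moreover have "(t * r) *\<^sub>R x \<in> interior K"
        using scale_interior_K[OF t r(2)] scale_interior_C[OF x r(1)] by simp
      moreover have "t * r > 0" using t r by simp
      ultimately show "x \<in> ?U" using x p by (intro UN_I[of p] UN_I[of "t * r"]) auto
    qed
    show "?U \<subseteq> near s Q" using interior_subset by (fastforce simp: near_def)
  qed
  moreover have "open ?U"
    by (intro open_UN ballI open_Int open_interior open_vimage open_Collect_less continuous_intros)
  ultimately show ?thesis by (simp add: borel_open)
qed

lemma near_scale: assumes "t > 0" shows "t *\<^sub>R x \<in> near s Q \<longleftrightarrow> x \<in> near s Q"
proof -
  have *: "t *\<^sub>R x \<in> near s Q" if t: "t > 0" and "x \<in> near s Q" for t x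
  proof -
    from that(2) obtain p r where x: "x \<in> interior C" and p: "p \<in> polar \<inter> Q" and r: "r > 0" "r *\<^sub>R x \<in> K"
        and lt: "p \<bullet> (r *\<^sub>R x) < 1 + s" by (auto simp: near_def)
    have "(r / t) *\<^sub>R (t *\<^sub>R x) = r *\<^sub>R x" using t by simp
    then have "(r / t) *\<^sub>R (t *\<^sub>R x) \<in> K \<and> p \<bullet> ((r / t) *\<^sub>R (t *\<^sub>R x)) < 1 + s" using r lt by metis
    moreover have "r / t > 0" using r t by simp
    ultimately show ?thesis unfolding near_def using scale_interior_C[OF x t] p by blast
  qed
  show ?thesis using *[OF assms] *[of "1/t" "t *\<^sub>R x"] assms by auto
qed

lemma near_mono: assumes "s \<le> s'" shows "near s Q \<subseteq> near s' Q"
proof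
  fix x assume "x \<in> near s Q"
  then obtain p r where x: "x \<in> interior C" "p \<in> polar \<inter> Q" "r > 0" "r *\<^sub>R x \<in> K"
    and lt: "p \<bullet> (r *\<^sub>R x) < 1 + s" by (auto simp: near_def)
  have "p \<bullet> (r *\<^sub>R x) < 1 + s'" using lt assms by linarith
  then show "x \<in> near s' Q" using x unfolding near_def by blast
qed

lemma Inter_near_subset: assumes "closed Q" shows "(\<Inter>n. near (1 / real (Suc n)) Q) \<subseteq> touch Q"
proof
  fix x assume x: "x \<in> (\<Inter>n. near (1 / real (Suc n)) Q)"
  then have xC: "x \<in> interior C" by (auto simp: near_def)
  have "\<forall>n. \<exists>p r. p \<in> polar \<inter> Q \<and> r > 0 \<and> r *\<^sub>R x \<in> K \<and> p \<bullet> (r *\<^sub>R x) < 1 + 1 / real (Suc n)"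
    using x unfolding near_def by blast
  then obtain ps rs where "\<And>n. ps n \<in> polar \<inter> Q" "\<And>n. rs n > (0::real)" "\<And>n. rs n *\<^sub>R x \<in> K"
      "\<And>n. ps n \<bullet> (rs n *\<^sub>R x) < 1 + 1 / real (Suc n)" by metis
  then have "\<exists>p\<in>Q. contact x p"
    using xC LIMSEQ_inverse_real_of_nat
    by (intro contact_limit[OF xC tendsto_const assms, of ps rs "\<lambda>n. 1 / real (Suc n)"])
       (auto intro: less_imp_le simp: inverse_eq_divide)
  then show "x \<in> touch Q" using xC by (simp add: touch_def)
qed

lemma shrink_pseudo_cone: assumes s: "s \<ge> 0" shows "C_pseudo_cone C (shrink s Q)"
proof -
  have eq: "shrink s Q = K \<inter> (\<Inter>p\<in>polar \<inter> Q. {x. p \<bullet> x \<ge> 1 + s})" by (auto simp: shrink_def)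
  have "closed (shrink s Q)" unfolding eq using closed_K by (auto intro!: closed_INT closed_halfspace_ge)
  moreover have "convex (shrink s Q)" unfolding eq
    using convex_K by (intro convex_Int convex_INT ballI convex_halfspace_ge)
  moreover have "shrink s Q \<noteq> {}"
  proof -
    obtain y where y: "y \<in> K" using nonempty_K by blast
    have "1 + s \<le> p \<bullet> ((1 + s) *\<^sub>R y)" if "p \<in> polar \<inter> Q" for p
    proof -
      have "1 \<le> p \<bullet> y" using that y by (simp add: polar_def)
      then have "(1 + s) * 1 \<le> (1 + s) * (p \<bullet> y)" using s by (intro mult_left_mono) auto
      then show ?thesis by simp
    qed
    then have "(1 + s) *\<^sub>R y \<in> shrink s Q" using scale_K[of "1 + s" y] y s by (simp add: shrink_def)
    then show ?thesis by blast
  qed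
  moreover have "x + z \<in> shrink s Q" if "x \<in> shrink s Q" "z \<in> C" for x z
  proof -
    have "1 + s \<le> p \<bullet> (x + z)" if "p \<in> polar \<inter> Q" for p
    proof -
      have "1 + s \<le> p \<bullet> x" using \<open>x \<in> shrink s Q\<close> that by (simp add: shrink_def)
      moreover have "0 \<le> p \<bullet> z" using that \<open>z \<in> C\<close> by (intro polar_dual) auto
      ultimately show ?thesis by (simp add: inner_add_right)
    qed
    then show ?thesis using that plus_K by (simp add: shrink_def)
  qed
  moreover have "shrink s Q \<subseteq> K" by (auto simp: shrink_def)
  ultimately show ?thesis unfolding C_pseudo_cone_iff using zero_K K_subset_C by blast
qed

text \<open>Contact vectors at \<open>x\<close> minimize \<open>p \<bullet> x\<close> over
  \<open>polar\<close>, so they are supergradients of a concave function; adding the two minimality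
  inequalities gives the claim.\<close>

lemma contact_inner_le:
  assumes "contact x p" "contact x' p'" shows "p \<bullet> (x' - x) \<ge> p' \<bullet> (x' - x)"
proof -
  have *: "p \<bullet> x' \<ge> p' \<bullet> x'" if c: "contact x p" "contact x' p'" for x x' p p'
  proof -
    obtain r where r: "r > 0" "r *\<^sub>R x' \<in> K" "p' \<bullet> (r *\<^sub>R x') = 1" using c(2) by (auto simp: contact_def)
    have "1 \<le> p \<bullet> (r *\<^sub>R x')" using c(1) r(2) unfolding contact_def polar_def by blast
    then have "r * (p' \<bullet> x') \<le> r * (p \<bullet> x')" using r(3) by simp
    then show ?thesis using r(1) by simp
  qed
  show ?thesis using *[OF assms] *[OF assms(2,1)] by (simp add: inner_diff_right)
qed

text \<open>The rays with more than one contact vector: two such vectors differ in some coordinate,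
  and rationals \<open>c < d\<close> fit in between. The union is countable.\<close>

definition multiple_contact :: "'a set" where
  "multiple_contact = (\<Union>b\<in>Basis. \<Union>c\<in>\<rat>. \<Union>d\<in>\<rat> \<inter> {c<..}. touch {p. b \<bullet> p \<le> c} \<inter> touch {p. b \<bullet> p \<ge> d})"

text \<open>On a line in direction \<^term>\<open>b\<close> the contact vectors have decreasing \<^term>\<open>b\<close>-components, so each piece of
  \<^term>\<open>multiple_contact\<close> meets such a line at most once.\<close>

lemma multiple_contact_null: "multiple_contact \<in> null_sets lborel"
proof -
  have "touch {p. b \<bullet> p \<le> c} \<inter> touch {p. b \<bullet> p \<ge> d} \<in> null_sets lborel" if "c < d" for b c d
  proof (rule null_sets_one_per_line)
    show "touch {p. b \<bullet> p \<le> c} \<inter> touch {p. b \<bullet> p \<ge> d} \<in> sets borel"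
      by (intro sets.Int touch_borel closed_halfspace_le closed_halfspace_ge)
    fix x and t :: real
    assume x: "x \<in> touch {p. b \<bullet> p \<le> c} \<inter> touch {p. b \<bullet> p \<ge> d}" and t: "t > 0"
    show "x + t *\<^sub>R b \<notin> touch {p. b \<bullet> p \<le> c} \<inter> touch {p. b \<bullet> p \<ge> d}"
    proof
      assume "x + t *\<^sub>R b \<in> touch {p. b \<bullet> p \<le> c} \<inter> touch {p. b \<bullet> p \<ge> d}"
      then obtain p p' where p: "contact x p" "b \<bullet> p \<le> c" "contact (x + t *\<^sub>R b) p'" "b \<bullet> p' \<ge> d"
        using x by (auto simp: touch_def)
      have "p \<bullet> (t *\<^sub>R b) \<ge> p' \<bullet> (t *\<^sub>R b)" using contact_inner_le[OF p(1,3)] by simp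
      then have "p \<bullet> b \<ge> p' \<bullet> b" using t by simp
      then show False using p(2,4) that by (simp add: inner_commute)
    qed
  qed
  then show ?thesis unfolding multiple_contact_def
    by (intro null_sets_UN' countable_finite[OF finite_Basis] countable_rat countable_Int1) auto
qed

lemma multiple_contactI:
  assumes "x \<in> interior C" "contact x p" "contact x p'" "p \<noteq> p'" shows "x \<in> multiple_contact"
proof -
  have main: "x \<in> multiple_contact" if c: "contact x p" "contact x p'" and b: "b \<in> Basis" "b \<bullet> p < b \<bullet> p'" for b p p'
  proof -
    obtain c where c1: "c \<in> \<rat>" "b \<bullet> p < c" "c < b \<bullet> p'" using Rats_dense_in_real[OF b(2)] by blast
    obtain d where d1: "d \<in> \<rat>" "c < d" "d < b \<bullet> p'" using Rats_dense_in_real[OF c1(3)] by blast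
    have "x \<in> touch {p. b \<bullet> p \<le> c} \<inter> touch {p. b \<bullet> p \<ge> d}"
      using assms(1) c c1 d1 by (auto simp: touch_def intro!: less_imp_le)
    then show ?thesis unfolding multiple_contact_def using b(1) c1(1) d1 by blast
  qed
  obtain b where "b \<in> Basis" "p \<bullet> b \<noteq> p' \<bullet> b" using assms(4) euclidean_eq_iff by blast
  then show ?thesis using main[of p p' b] main[of p' p b] assms(2,3) by (metis inner_commute linorder_neqE)
qed

section \<open>Contact vectors and outer unit normals\<close>

lemma contact_scale: assumes "t > 0" shows "contact (t *\<^sub>R x) p \<longleftrightarrow> contact x p"
proof -
  have *: "contact (t *\<^sub>R x) p" if t: "t > 0" and c: "contact x p" for t x
  proof -
    obtain r where r: "r > 0" "r *\<^sub>R x \<in> K" "p \<bullet> (r *\<^sub>R x) = 1" using c by (auto simp: contact_def)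
    have "(r / t) *\<^sub>R (t *\<^sub>R x) = r *\<^sub>R x" using t by simp
    then have "(r / t) *\<^sub>R (t *\<^sub>R x) \<in> K \<and> p \<bullet> ((r / t) *\<^sub>R (t *\<^sub>R x)) = 1" using r by metis
    moreover have "r / t > 0" using r t by simp
    ultimately show ?thesis using c unfolding contact_def by blast
  qed
  show ?thesis using *[OF assms, of x] *[of "1/t" "t *\<^sub>R x"] assms by auto
qed

text \<open>A normal is nonpositive on \<open>C\<close>, hence negative at the interior point
  \<open>x\<close>; dividing by \<open>u \<bullet> x\<close> normalizes the supporting value to
  1.\<close>

lemma outer_normal_contact:
  assumes x: "x \<in> K" "x \<in> interior C" and u: "outer_unit_normal K x u"
  shows "u \<bullet> x < 0" "contact x ((1 / (u \<bullet> x)) *\<^sub>R u)"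
proof -
  have n: "norm u = 1" and le: "\<And>y. y \<in> K \<Longrightarrow> u \<bullet> (y - x) \<le> 0" using u by (auto simp: outer_unit_normal_def)
  have dual: "0 \<le> (- u) \<bullet> y" if "y \<in> C" for y using le[of "x + y"] plus_K[OF x(1) that] by simp
  obtain c e where ce: "c > 0" "e > 0"
    "\<And>x' p. dist x x' < e \<Longrightarrow> (\<And>y. y \<in> C \<Longrightarrow> 0 \<le> p \<bullet> y) \<Longrightarrow> c * norm p \<le> p \<bullet> x'" using interior_gap x(2) by blast
  have "c * norm (- u) \<le> (- u) \<bullet> x" using ce dual by (intro ce(3)) auto
  then show neg: "u \<bullet> x < 0" using n ce(1) by simp
  have "1 \<le> (u \<bullet> y) / (u \<bullet> x)" if "y \<in> K" for y
    using le[OF that] neg by (simp add: inner_diff_right)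
  then have "(1 / (u \<bullet> x)) *\<^sub>R u \<in> polar" unfolding polar_def by simp
  moreover have "((1 / (u \<bullet> x)) *\<^sub>R u) \<bullet> (1 *\<^sub>R x) = 1" using neg by simp
  ultimately show "contact x ((1 / (u \<bullet> x)) *\<^sub>R u)" unfolding contact_def using x(1)
    by (metis scaleR_one zero_less_one)
qed

lemma polar_nonzero: "p \<in> polar \<Longrightarrow> p \<noteq> 0"
  using nonempty_K by (auto simp: polar_def)

definition unit_normal_of :: "'a \<Rightarrow> 'a" where
  "unit_normal_of p = - ((1 / norm p) *\<^sub>R p)"

lemma contact_outer_normal:
  assumes p: "p \<in> polar" and x: "x \<in> K" "p \<bullet> x = 1"
  shows "outer_unit_normal K x (unit_normal_of p)" "x \<in> frontier K"
proof -
  have p0: "norm p > 0" using polar_nonzero[OF p] by simp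
  have "unit_normal_of p \<bullet> (y - x) \<le> 0" if "y \<in> K" for y
  proof -
    have "1 \<le> p \<bullet> y" using p that by (simp add: polar_def)
    then have "p \<bullet> (y - x) \<ge> 0" using x(2) by (simp add: inner_diff_right)
    then show ?thesis using p0 by (simp add: unit_normal_of_def)
  qed
  moreover have "norm (unit_normal_of p) = 1" using p0 by (simp add: unit_normal_of_def)
  ultimately show "outer_unit_normal K x (unit_normal_of p)" by (simp add: outer_unit_normal_def)
  show "x \<in> frontier K"
  proof (rule ccontr)
    assume "x \<notin> frontier K"
    then have "x \<in> interior K" using x(1) closed_K by (simp add: frontier_def)
    then obtain e where e: "e > 0" "cball x e \<subseteq> K" using mem_interior_cball by blast
    have "x - (e / norm p) *\<^sub>R p \<in> K" using e p0 by (intro subsetD[OF e(2)]) (simp add: dist_norm)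
    then have "1 \<le> p \<bullet> (x - (e / norm p) *\<^sub>R p)" using p by (simp add: polar_def)
    then have "(e / norm p) * (p \<bullet> p) \<le> 0" using x(2) by (simp add: inner_diff_right)
    moreover have "(e / norm p) * (p \<bullet> p) > 0" using e(1) p0 by simp
    ultimately show False by simp
  qed
qed

lemma unit_normal_of_normal: "norm u = 1 \<Longrightarrow> t < 0 \<Longrightarrow> unit_normal_of (t *\<^sub>R u) = u"
  by (simp add: unit_normal_of_def)

text \<open>A ray inside \<open>interior C\<close> crosses \<open>frontier K\<close> only once:
  \<open>r < 1\<close> would put \<open>x\<close> into \<open>interior K\<close>, and
  \<open>r > 1\<close> would give \<open>p\<close> a value above 1.\<close>

lemma contact_frontier_point:
  assumes x: "x \<in> frontier K" "x \<in> interior C" and c: "contact x p" shows "p \<bullet> x = 1"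
proof -
  obtain r where r: "r > 0" "r *\<^sub>R x \<in> K" "p \<bullet> (r *\<^sub>R x) = 1" using c by (auto simp: contact_def)
  have xK: "x \<in> K" using x(1) closed_K frontier_subset_closed by blast
  have pP: "p \<in> polar" using c by (simp add: contact_def)
  have "\<not> r < 1"
  proof
    assume "r < 1"
    then have "(1 / r) *\<^sub>R (r *\<^sub>R x) \<in> interior K"
      using r by (intro scale_interior_K scale_interior_C x) auto
    then show False using x(1) r(1) by (simp add: frontier_def)
  qed
  moreover have "\<not> 1 < r"
  proof
    assume "1 < r"
    have "1 \<le> p \<bullet> x" using pP xK by (simp add: polar_def)
    then have "1 < r * (p \<bullet> x)" using \<open>1 < r\<close> by (metis less_le_trans mult.right_neutral mult_left_mono less_imp_le zero_le_one order.trans)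
    then show False using r(3) by simp
  qed
  ultimately show ?thesis using r(3) by simp
qed

section \<open>Points below the boundary with a unique contact vector\<close>

definition regular :: "'a set" where
  "regular = {x \<in> interior C - K. \<exists>!p. contact x p}"

text \<open>The default 0 is never a contact vector, because \<open>polar\<close> does not contain
  it.\<close>

definition contact_of :: "'a \<Rightarrow> 'a" where
  "contact_of x = (if x \<in> regular then THE p. contact x p else 0)"

lemma contact_of: assumes "x \<in> regular" shows "contact x p \<longleftrightarrow> p = contact_of x"
proof -
  have ex: "\<exists>!p. contact x p" using assms by (simp add: regular_def)
  have "contact_of x = (THE p. contact x p)" using assms by (simp add: contact_of_def)
  then show ?thesis using theI'[OF ex] ex by metis
qed

lemma regular_D: "x \<in> regular \<Longrightarrow> x \<in> interior C" "x \<in> regular \<Longrightarrow> x \<notin> K"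
  by (auto simp: regular_def)

lemma regularI: assumes "x \<in> interior C" "x \<notin> K" "x \<notin> multiple_contact" "contact x p" shows "x \<in> regular"
  using assms multiple_contactI unfolding regular_def by blast

text \<open>Restates the union of segments in terms of contact vectors. The excluded frontiers are
  null sets; off them a point on a segment is interior to \<open>C\<close> and strictly below
  \<open>K\<close>.\<close>

lemma segment_regular_iff:
  assumes y: "y \<notin> frontier C" "y \<notin> frontier K"
  shows "y \<in> (\<Union>x\<in>reverse_gauss_image K \<omega>. closed_segment 0 x) \<longleftrightarrow>
    y \<in> regular \<and> unit_normal_of (contact_of y) \<in> \<omega>"
proof
  assume "y \<in> (\<Union>x\<in>reverse_gauss_image K \<omega>. closed_segment 0 x)"
  then obtain x l where x: "x \<in> reverse_gauss_image K \<omega>" and l: "0 \<le> l" "l \<le> 1" "y = l *\<^sub>R x"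
    by (auto simp: in_segment)
  have xf: "x \<in> frontier K" and ex: "\<exists>!u. outer_unit_normal K x u" and g: "gauss_map K x \<in> \<omega>"
    using x by (auto simp: reverse_gauss_image_def)
  define u where "u = gauss_map K x"
  have u: "outer_unit_normal K x u" and uu: "\<And>v. outer_unit_normal K x v \<Longrightarrow> v = u"
    using theI'[OF ex] ex unfolding u_def gauss_map_def by auto
  have xK: "x \<in> K" using xf closed_K frontier_subset_closed by blast
  have "y \<in> C" using l xK K_subset_C scale_C by auto
  then have yC: "y \<in> interior C" using y(1) closed_C by (simp add: frontier_def)
  then have "y \<noteq> 0" by (rule interior_nonzero)
  then have l0: "l > 0" using l by (metis order_le_less scaleR_zero_left)
  have xC: "x \<in> interior C" using yC l0 scale_interior_C_iff l(3) by blast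
  have yK: "y \<notin> K"
  proof
    assume "y \<in> K"
    then have "y \<in> interior K" using y(2) closed_K by (simp add: frontier_def)
    then have "(1 / l) *\<^sub>R y \<in> interior K" using l0 l(2) by (intro scale_interior_K') auto
    then show False using xf l0 l(3) by (simp add: frontier_def)
  qed
  define p where "p = (1 / (u \<bullet> x)) *\<^sub>R u"
  have neg: "u \<bullet> x < 0" and cp: "contact x p" using outer_normal_contact[OF xK xC u] by (auto simp: p_def)
  \<comment> \<open>Every contact vector yields an outer unit normal at \<open>x\<close>, hence is a
    multiple of \<open>u\<close>; its value 1 at \<open>x\<close> fixes the factor.\<close>
  have uniq: "p' = p" if c: "contact x p'" for p'
  proof -
    have pP: "p' \<in> polar" using c by (simp add: contact_def)
    have px: "p' \<bullet> x = 1" by (rule contact_frontier_point[OF xf xC c])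
    have un: "unit_normal_of p' = u" using contact_outer_normal(1)[OF pP xK px] uu by blast
    have p'0: "norm p' > 0" using polar_nonzero[OF pP] by simp
    have "p' = - norm p' *\<^sub>R u" using p'0 unfolding un[symmetric] unit_normal_of_def by simp
    then obtain k where k: "p' = k *\<^sub>R u" by blast
    then have "k * (u \<bullet> x) = 1" using px by simp
    then have "k = 1 / (u \<bullet> x)" using neg by (simp add: field_simps)
    then show ?thesis using k by (simp add: p_def)
  qed
  have "contact y p' \<longleftrightarrow> contact x p'" for p' using contact_scale[OF l0, of x p'] l(3) by simp
  then have cy: "contact y p' \<longleftrightarrow> p' = p" for p' using uniq cp by blast
  then have "\<exists>!p. contact y p" by (intro ex1I[of _ p]) simp_all
  then have reg: "y \<in> regular" using yC yK by (simp add: regular_def)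
  have "contact_of y = p" using cy contact_of[OF reg] by blast
  moreover have "unit_normal_of p = u" unfolding p_def
    using u neg by (intro unit_normal_of_normal) (auto simp: outer_unit_normal_def)
  ultimately show "y \<in> regular \<and> unit_normal_of (contact_of y) \<in> \<omega>" using reg g u_def by simp
next
  assume "y \<in> regular \<and> unit_normal_of (contact_of y) \<in> \<omega>"
  then have reg: "y \<in> regular" and \<omega>: "unit_normal_of (contact_of y) \<in> \<omega>" by auto
  define p where "p = contact_of y"
  have cp: "contact y p" using contact_of[OF reg] by (simp add: p_def)
  then obtain r where r: "r > 0" "r *\<^sub>R y \<in> K" "p \<bullet> (r *\<^sub>R y) = 1" and pP: "p \<in> polar" by (auto simp: contact_def)
  define x where "x = r *\<^sub>R y"
  have xK: "x \<in> K" using r by (simp add: x_def)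
  have xC: "x \<in> interior C" unfolding x_def using regular_D[OF reg] r by (intro scale_interior_C)
  have r1: "r > 1"
  proof (rule ccontr)
    assume "\<not> r > 1"
    then have "(1 / r) *\<^sub>R x \<in> K" using r(1) xK by (intro scale_K) auto
    then show False using regular_D[OF reg] r(1) by (simp add: x_def)
  qed
  have yx: "y = (1 / r) *\<^sub>R x" using r(1) by (simp add: x_def)
  have seg: "y \<in> closed_segment 0 x" unfolding in_segment using r1 yx by (intro exI[of _ "1 / r"]) auto
  have norm: "outer_unit_normal K x (unit_normal_of p)" and xf: "x \<in> frontier K"
    using contact_outer_normal[OF pP xK] r(3) by (auto simp: x_def)
  have uniq: "v = unit_normal_of p" if v: "outer_unit_normal K x v" for v
  proof -
    have vneg: "v \<bullet> x < 0" and "contact x ((1 / (v \<bullet> x)) *\<^sub>R v)" using outer_normal_contact[OF xK xC v] by auto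
    then have "contact y ((1 / (v \<bullet> x)) *\<^sub>R v)" using contact_scale[OF r(1), of y] by (simp add: x_def)
    then have "p = (1 / (v \<bullet> x)) *\<^sub>R v" using contact_of[OF reg] by (simp add: p_def)
    then show ?thesis using v vneg unit_normal_of_normal[of v "1 / (v \<bullet> x)"] by (simp add: outer_unit_normal_def)
  qed
  have "gauss_map K x = unit_normal_of p" unfolding gauss_map_def using norm uniq by (rule the_equality)
  then have "gauss_map K x \<in> \<omega>" using \<omega> by (simp add: p_def)
  moreover have "\<exists>!u. outer_unit_normal K x u" using norm uniq by (rule ex1I)
  ultimately have "x \<in> reverse_gauss_image K \<omega>" using xf by (simp add: reverse_gauss_image_def)
  then show "y \<in> (\<Union>x\<in>reverse_gauss_image K \<omega>. closed_segment 0 x)" using seg by blast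
qed

end

section \<open>First variation\<close>

locale weighted_pseudo_cone = weighted_cone C \<Theta> q + pseudo_cone_in C K
  for C :: "'a::euclidean_space set" and \<Theta> q K
begin

lemma closed_difference_borel: "C - K \<in> sets borel"
  using closed_C closed_K by auto

lemma \<mu>_Int_complement_finite: "emeasure \<mu> ((C - K) \<inter> A) < \<infinity>"
proof -
  have "emeasure \<mu> ((C - K) \<inter> A) \<le> emeasure \<mu> (C - K)"
    using closed_difference_borel by (intro emeasure_mono) auto
  then show ?thesis using \<mu>_complement_finite[OF K] by (rule order.strict_trans1)
qed

text \<open>What is lost by shrinking lies between the part of \<^term>\<open>C - K\<close> in the cone \<^term>\<open>near s Q\<close> and its
  dilate by \<^term>\<open>1 + s\<close>; this replaces polar coordinates.\<close>

lemma \<mu>_shrink_le: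
  assumes s: "s \<ge> 0"
  shows "emeasure \<mu> (C - shrink s Q) \<le>
    emeasure \<mu> (C - K) + ennreal ((1 + s) powr \<alpha> - 1) * emeasure \<mu> ((C - K) \<inter> near s Q)"
proof -
  define Y where "Y = (C - K) \<inter> near s Q"
  have Y: "Y \<in> sets borel" unfolding Y_def using closed_difference_borel near_borel by blast
  define Z where "Z = (*\<^sub>R) (1 + s) ` Y"
  have Z: "Z \<in> sets borel" unfolding Z_def using s by (intro borel_image_scaleR Y) auto
  have fin: "emeasure \<mu> Y < \<infinity>" unfolding Y_def by (rule \<mu>_Int_complement_finite)
  have resc: "(1 + s) *\<^sub>R ((1 / (1 + s)) *\<^sub>R x) = x" for x :: 'a using s by simp
  obtain y where y: "emeasure \<mu> Y = ennreal y" "y \<ge> 0" using fin by (cases "emeasure \<mu> Y") auto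
  have eZ: "emeasure \<mu> Z = ennreal ((1 + s) powr \<alpha>) * emeasure \<mu> Y"
    unfolding Z_def using s Y by (intro emeasure_\<mu>_scale) auto
  have YZ: "Y \<subseteq> Z"
  proof
    fix x assume x: "x \<in> Y"
    have "(1 / (1 + s)) *\<^sub>R x \<notin> K"
    proof
      assume "(1 / (1 + s)) *\<^sub>R x \<in> K"
      then have "(1 + s) *\<^sub>R ((1 / (1 + s)) *\<^sub>R x) \<in> K" by (rule scale_K[rotated]) (use s in simp)
      then show False using x unfolding resc by (simp add: Y_def)
    qed
    moreover have "(1 / (1 + s)) *\<^sub>R x \<in> C" using x s by (intro scale_C) (auto simp: Y_def)
    moreover have "(1 / (1 + s)) *\<^sub>R x \<in> near s Q" using x s by (subst near_scale) (auto simp: Y_def)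
    ultimately have "(1 + s) *\<^sub>R ((1 / (1 + s)) *\<^sub>R x) \<in> Z" unfolding Z_def Y_def by blast
    then show "x \<in> Z" unfolding resc .
  qed
  \<comment> \<open>A point \<open>x\<close> of \<open>K\<close> that is lost has
    \<open>p \<bullet> x < 1 + s\<close> for some \<open>p \<in> polar \<inter> Q\<close>, so
    \<open>x / (1 + s)\<close> is outside \<open>K\<close>. The frontier of \<open>C\<close> is set
    aside because \<open>near s Q\<close> lives in \<open>interior C\<close>.\<close>
  have sub: "C - shrink s Q \<subseteq> ((C - K) \<union> (Z - Y)) \<union> frontier C"
  proof
    fix x assume x: "x \<in> C - shrink s Q"
    show "x \<in> ((C - K) \<union> (Z - Y)) \<union> frontier C"
    proof (cases "x \<in> frontier C \<or> x \<notin> K")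
      case False
      then have xK: "x \<in> K" and xC: "x \<in> interior C" using x closed_C by (auto simp: frontier_def)
      then obtain p where p: "p \<in> polar \<inter> Q" "p \<bullet> x < 1 + s" using x by (auto simp: shrink_def not_le)
      have nx: "x \<in> near s Q" unfolding near_def using xC p xK by (auto intro!: bexI[of _ p] exI[of _ 1])
      have "(1 / (1 + s)) *\<^sub>R x \<notin> K"
      proof
        assume "(1 / (1 + s)) *\<^sub>R x \<in> K"
        then have "1 \<le> p \<bullet> ((1 / (1 + s)) *\<^sub>R x)" using p(1) unfolding polar_def by blast
        then show False using p(2) s by (simp add: field_simps)
      qed
      moreover have "(1 / (1 + s)) *\<^sub>R x \<in> C" using x s by (intro scale_C) auto
      moreover have "(1 / (1 + s)) *\<^sub>R x \<in> near s Q" using nx s by (subst near_scale) auto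
      ultimately have "(1 + s) *\<^sub>R ((1 / (1 + s)) *\<^sub>R x) \<in> Z" unfolding Z_def Y_def by blast
      then have "x \<in> Z" unfolding resc .
      then show ?thesis using xK by (simp add: Y_def)
    qed (use x in auto)
  qed
  have null: "frontier C \<in> null_sets \<mu>" by (intro null_\<mu> null_sets_frontier_convex convex_C)
  have bm: "(C - K) \<union> (Z - Y) \<in> sets \<mu>" using closed_difference_borel Y Z by auto
  have "emeasure \<mu> (C - shrink s Q) \<le> emeasure \<mu> (((C - K) \<union> (Z - Y)) \<union> frontier C)"
    using sub bm null by (intro emeasure_mono) auto
  also have "\<dots> = emeasure \<mu> ((C - K) \<union> (Z - Y))" by (rule emeasure_Un_null_set[OF bm null])
  also have "\<dots> \<le> emeasure \<mu> (C - K) + emeasure \<mu> (Z - Y)"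
    using closed_difference_borel Y Z by (intro emeasure_subadditive) auto
  also have "emeasure \<mu> (Z - Y) = emeasure \<mu> Z - emeasure \<mu> Y"
    using Y Z YZ fin by (intro emeasure_Diff) auto
  also have "\<dots> = ennreal ((1 + s) powr \<alpha> - 1) * emeasure \<mu> Y"
  proof -
    have "emeasure \<mu> Z - emeasure \<mu> Y = ennreal ((1 + s) powr \<alpha> * y) - ennreal y"
      using y by (simp add: eZ ennreal_mult'')
    also have "\<dots> = ennreal ((1 + s) powr \<alpha> * y - y)" using y by (simp add: ennreal_minus)
    also have "(1 + s) powr \<alpha> * y - y = ((1 + s) powr \<alpha> - 1) * y" by (simp add: algebra_simps)
    finally show ?thesis using y by (simp add: ennreal_mult'')
  qed
  finally show ?thesis by (simp add: Y_def)
qed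

section \<open>Measurability and the cone-volume measure\<close>

lemma regular_eq: "regular = (interior C - K) \<inter> touch UNIV - multiple_contact"
proof -
  have "\<not> (\<exists>!p. contact x p)" if x: "x \<in> multiple_contact" for x
  proof -
    obtain b c d where "c < d" and "x \<in> touch {p. b \<bullet> p \<le> c}" "x \<in> touch {p. b \<bullet> p \<ge> d}"
      using x unfolding multiple_contact_def by auto
    then obtain p p' where p: "contact x p" "b \<bullet> p \<le> c" "contact x p'" "b \<bullet> p' \<ge> d" unfolding touch_def by blast
    then have "p \<noteq> p'" using \<open>c < d\<close> by auto
    then show ?thesis using p by blast
  qed
  then have multi: "x \<notin> multiple_contact" if "x \<in> regular" for x using that unfolding regular_def by blast
  show ?thesis
  proof (intro subset_antisym subsetI)
    fix x assume x: "x \<in> regular"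
    then have "x \<in> touch UNIV" unfolding regular_def touch_def by blast
    then show "x \<in> (interior C - K) \<inter> touch UNIV - multiple_contact"
      using x regular_D[OF x] multi[OF x] by simp
  next
    fix x assume x: "x \<in> (interior C - K) \<inter> touch UNIV - multiple_contact"
    then obtain p where "contact x p" unfolding touch_def by blast
    then show "x \<in> regular" using x by (intro regularI) auto
  qed
qed

lemma regular_borel: "regular \<in> sets borel"
proof -
  have "interior C - K \<in> sets borel" using closed_K by auto
  moreover have "multiple_contact \<in> sets borel" using multiple_contact_null by (auto simp: null_sets_def)
  ultimately show ?thesis unfolding regular_eq using touch_borel[of UNIV] by auto
qed

text \<open>On \<open>regular\<close> the preimage of a closed \<open>Q\<close> is cut out by the
  Borel set \<open>touch Q\<close>; the default value accounts for the rest.\<close>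

lemma contact_of_measurable: "contact_of \<in> borel_measurable borel"
proof -
  have cl: "contact_of -` Q \<in> sets borel" if "closed Q" for Q
  proof -
    have "contact_of -` Q = regular \<inter> touch Q \<union> (if 0 \<in> Q then - regular else {})" (is "_ = ?R")
    proof (rule set_eqI)
      fix x show "x \<in> contact_of -` Q \<longleftrightarrow> x \<in> ?R"
      proof (cases "x \<in> regular")
        case True
        then show ?thesis using contact_of[OF True] regular_D(1)[OF True] by (auto simp: touch_def)
      next
        case False
        then show ?thesis by (simp add: contact_of_def)
      qed
    qed
    moreover have "- regular \<in> sets borel" using regular_borel by (rule borel_comp)
    ultimately show ?thesis using regular_borel touch_borel[OF that] by auto
  qed
  show ?thesis
  proof (rule borel_measurableI)
    fix S :: "'a set" assume "open S"
    then have "contact_of -` (- S) \<in> sets borel" by (intro cl) auto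
    then have "- (contact_of -` (- S)) \<in> sets borel" by (rule borel_comp)
    then show "contact_of -` S \<inter> space borel \<in> sets borel" by (simp add: vimage_Compl)
  qed
qed

definition normal_at :: "'a \<Rightarrow> 'a" where
  "normal_at y = unit_normal_of (contact_of y)"

lemma normal_at_measurable [measurable]: "normal_at \<in> borel_measurable borel"
  unfolding normal_at_def unit_normal_of_def using contact_of_measurable by measurable

lemma normal_preimage_borel:
  assumes "\<omega> \<in> sets borel" shows "{y \<in> regular. normal_at y \<in> \<omega>} \<in> sets borel"
proof -
  have "{y \<in> regular. normal_at y \<in> \<omega>} = regular \<inter> (normal_at -` \<omega> \<inter> space borel)" by auto
  then show ?thesis using regular_borel measurable_sets[OF normal_at_measurable assms] by auto
qed

text \<open>The union of segments is not shown to be Borel; it agrees almost everywhere with a Borel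
  set, which suffices for the nonnegative integral.\<close>

lemma weighted_cone_volume_eq:
  assumes "\<omega> \<in> sets borel"
  shows "weighted_cone_volume \<Theta> K \<omega> = emeasure \<mu> {y \<in> regular. normal_at y \<in> \<omega>}"
proof -
  define U where "U = (\<Union>x\<in>reverse_gauss_image K \<omega>. closed_segment 0 x)"
  define W where "W = {y \<in> regular. normal_at y \<in> \<omega>}"
  have "AE y in lborel. y \<notin> frontier C \<and> y \<notin> frontier K"
    using AE_not_in[OF null_sets_frontier_convex[OF convex_C]] AE_not_in[OF null_sets_frontier_convex[OF convex_K]]
    by eventually_elim auto
  then have "AE y in lborel. ennreal (\<Theta> y) * indicator U y = weight y * indicator W y"
  proof eventually_elim
    fix y assume "y \<notin> frontier C \<and> y \<notin> frontier K"
    then have iff: "y \<in> U \<longleftrightarrow> y \<in> W"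
      using segment_regular_iff[of y \<omega>] by (simp add: normal_at_def U_def W_def)
    have "weight y = ennreal (\<Theta> y)" if "y \<in> W"
    proof -
      have "y \<in> interior C" using that regular_D(1) by (simp add: W_def)
      then show ?thesis using interior_C_D interior_nonzero by (simp add: weight_def)
    qed
    then show "ennreal (\<Theta> y) * indicator U y = weight y * indicator W y"
      using iff by (cases "y \<in> W") simp_all
  qed
  then show ?thesis
    unfolding weighted_cone_volume_def weighted_volume_def emeasure_\<mu>[OF normal_preimage_borel[OF assms]]
      U_def W_def by (rule nn_integral_cong_AE)
qed

lemma normal_preimage_le: "emeasure \<mu> {y \<in> regular. normal_at y \<in> \<omega>} \<le> emeasure \<mu> (C - K)"
proof (rule emeasure_mono)
  show "{y \<in> regular. normal_at y \<in> \<omega>} \<subseteq> C - K" using regular_D interior_C_D by blast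
qed (simp add: closed_difference_borel)

lemma weighted_cone_volume_finite: "weighted_cone_volume \<Theta> K (Omega_dual C) < \<infinity>"
  unfolding weighted_cone_volume_eq[OF Omega_borel]
  by (rule order.strict_trans1[OF normal_preimage_le \<mu>_complement_finite[OF K]])

text \<open>Off the null set \<open>multiple_contact\<close>, a contact vector in the hull is the
  only one, and as a positive multiple of some \<open>- u\<close> with \<open>u \<in> F\<close> it
  has the normal \<open>u\<close>.\<close>

lemma touch_conic_hull_le:
  assumes F: "compact F" "F \<subseteq> sphere 0 1"
  shows "emeasure \<mu> ((C - K) \<inter> touch (conic hull (uminus ` F))) \<le> emeasure \<mu> {y \<in> regular. normal_at y \<in> F}"
proof -
  have bF: "{y \<in> regular. normal_at y \<in> F} \<in> sets \<mu>"
    using normal_preimage_borel[OF borel_closed[OF compact_imp_closed[OF F(1)]]] by simp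
  have null: "multiple_contact \<in> null_sets \<mu>" by (rule null_\<mu>[OF multiple_contact_null])
  have "(C - K) \<inter> touch (conic hull (uminus ` F)) \<subseteq> {y \<in> regular. normal_at y \<in> F} \<union> multiple_contact"
  proof
    fix y assume y: "y \<in> (C - K) \<inter> touch (conic hull (uminus ` F))"
    show "y \<in> {y \<in> regular. normal_at y \<in> F} \<union> multiple_contact"
    proof (cases "y \<in> multiple_contact")
      case False
      obtain t u where t: "t \<ge> 0" and u: "u \<in> F" and c: "contact y ((- t) *\<^sub>R u)" and yC: "y \<in> interior C"
        using y by (auto simp: touch_def conic_hull_explicit)
      have reg: "y \<in> regular" using regularI[OF yC _ False c] y by blast
      have "(- t) *\<^sub>R u \<noteq> 0" using c polar_nonzero unfolding contact_def by blast
      then have "- t < 0" using t by auto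
      moreover have "norm u = 1" using F(2) u by auto
      ultimately have "unit_normal_of ((- t) *\<^sub>R u) = u" by (intro unit_normal_of_normal)
      then have "normal_at y = u" using contact_of[OF reg] c unfolding normal_at_def by metis
      then show ?thesis using reg u by simp
    qed simp
  qed
  then have "emeasure \<mu> ((C - K) \<inter> touch (conic hull (uminus ` F))) \<le> emeasure \<mu> ({y \<in> regular. normal_at y \<in> F} \<union> multiple_contact)"
    using bF null by (intro emeasure_mono) auto
  also have "\<dots> = emeasure \<mu> {y \<in> regular. normal_at y \<in> F}" by (rule emeasure_Un_null_set[OF bF null])
  finally show ?thesis .
qed

text \<open>The second bound applies the displaced constraint to \<open>p = - u / gap K u\<close>,
  which lies in \<open>polar\<close>, and in \<open>Q\<close> because \<open>Q\<close> is
  conic.\<close>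

lemma gap_shrink:
  assumes s: "s \<ge> 0" and u: "u \<in> interior (dual_cone C)"
  shows "gap K u \<le> gap (shrink s Q) u"
    and "- u \<in> Q \<Longrightarrow> conic Q \<Longrightarrow> (1 + s) * gap K u \<le> gap (shrink s Q) u"
proof -
  have S: "pseudo_cone_in C (shrink s Q)" by unfold_locales (rule shrink_pseudo_cone[OF s])
  note ud = dual_interior_D[OF u]
  show "gap K u \<le> gap (shrink s Q) u"
  proof (rule pseudo_cone_in.gap_ge[OF S])
    fix x assume "x \<in> shrink s Q"
    then have "x \<in> K" by (simp add: shrink_def)
    then show "gap K u \<le> - (u \<bullet> x)" by (rule gap_le[OF ud])
  qed
  assume Q: "- u \<in> Q" "conic Q"
  have g: "gap K u > 0" by (rule gap_pos[OF u])
  define p where "p = (1 / gap K u) *\<^sub>R (- u)"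
  have "1 \<le> p \<bullet> y" if "y \<in> K" for y
    using gap_le[OF ud that] g by (simp add: p_def pos_divide_le_eq)
  then have "p \<in> polar" unfolding polar_def by blast
  moreover have "0 \<le> 1 / gap K u" using g by simp
  then have "p \<in> Q" using Q unfolding p_def conic_def by blast
  ultimately have p: "p \<in> polar \<inter> Q" by blast
  show "(1 + s) * gap K u \<le> gap (shrink s Q) u"
  proof (rule pseudo_cone_in.gap_ge[OF S])
    fix x assume "x \<in> shrink s Q"
    then have "1 + s \<le> p \<bullet> x" using p by (simp add: shrink_def)
    then have "(1 + s) * gap K u \<le> (p \<bullet> x) * gap K u" using g by (intro mult_right_mono) auto
    also have "(p \<bullet> x) * gap K u = - (u \<bullet> x)" using g by (simp add: p_def)
    finally show "(1 + s) * gap K u \<le> - (u \<bullet> x)" .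
  qed
qed

end

section \<open>From minimality to the prescribed measure\<close>

context prescribed_measure
begin

text \<open>The competitor \<open>shrink s Q\<close> raises the logarithm of the gap by
  \<open>ln (1 + s)\<close> on \<open>F\<close>, while its volume grows by at most
  \<open>((1 + s) powr \<alpha> - 1) * N s\<close>. With \<open>ln x \<le> x - 1\<close> minimality
  gives \<open>\<phi>(F) \<le> (1 + s) powr \<alpha> * N s\<close>; then \<open>s\<close> tends to
  0.\<close>

lemma minimizer_le_touch:
  assumes min: "minimizer K" and F: "compact F" "F \<subseteq> Omega_dual C"
  shows "measure \<phi> F \<le> measure \<mu> ((C - K) \<inter> pseudo_cone_in.touch C K (conic hull (uminus ` F)))"
proof -
  have CK: "C_pseudo_cone C K" using min by (simp add: minimizer_def admissible_def)
  interpret weighted_pseudo_cone C \<Theta> q K by unfold_locales (rule CK)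
  define Q where "Q = conic hull (uminus ` F)"
  have F1: "norm u = 1" if "u \<in> F" for u using F(2) that Omega_dual_D(2) by blast
  have "compact (uminus ` F)" using F(1) by (intro compact_continuous_image continuous_intros)
  moreover have "0 \<notin> uminus ` F" using F1[of 0] by auto
  ultimately have clQ: "closed Q" unfolding Q_def by (intro closed_conic_hull) auto
  have Q: "conic Q" unfolding Q_def by (rule conic_conic_hull)
  have uQ: "- u \<in> Q" if "u \<in> F" for u unfolding Q_def using that hull_subset[of "uminus ` F" conic] by blast
  have Fs: "F \<in> sets \<phi>" unfolding sets_\<phi> sets_restrict_space using F compact_imp_closed[OF F(1)] by (intro image_eqI[of _ _ F]) auto
  define N where "N s = measure \<mu> ((C - K) \<inter> near s Q)" for s
  have fin: "emeasure \<mu> ((C - K) \<inter> A) < \<infinity>" for A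
    by (rule \<mu>_Int_complement_finite)
  have eN: "emeasure \<mu> ((C - K) \<inter> near s Q) = ennreal (N s)" for s
    unfolding N_def using fin[of "near s Q"] by (intro emeasure_eq_ennreal_measure) auto
  have key: "measure \<phi> F \<le> (1 + s) powr \<alpha> * N s" if s: "s > 0" for s
  proof -
    have sc: "C_pseudo_cone C (shrink s Q)" using s by (intro shrink_pseudo_cone) auto
    define V where "V = measure \<mu> (C - shrink s Q)"
    have le: "ln (gap K u) + ln (1 + s) * indicator F u \<le> ln (gap (shrink s Q) u)" if u: "u \<in> Omega_dual C" for u
    proof -
      have g: "gap K u > 0" using gap_pos Omega_dual_D[OF u] by blast
      note gs = gap_shrink[OF less_imp_le[OF s] Omega_dual_D(1)[OF u], of Q]
      show ?thesis
      proof (cases "u \<in> F")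
        case True
        have "ln (gap K u) + ln (1 + s) = ln ((1 + s) * gap K u)" using g s by (simp add: ln_mult)
        also have "\<dots> \<le> ln (gap (shrink s Q) u)" using gs(2)[OF uQ[OF True] Q] g s by (intro ln_mono) auto
        finally show ?thesis using True by simp
      next
        case False
        then show ?thesis using gs(1) g by simp
      qed
    qed
    have Vle: "ln (1 + s) * measure \<phi> F \<le> total_mass / \<alpha> * ln (V / total_mass)" and V: "V > 0"
      using minimizer_log_variation[OF min sc Fs le] by (auto simp: V_def)
    have N0: "N s \<ge> 0" by (simp add: N_def)
    have p1: "(1 + s) powr \<alpha> \<ge> 1" using s \<alpha> by (simp add: ge_one_powr_ge_zero)
    have "ennreal V \<le> ennreal total_mass + ennreal ((1 + s) powr \<alpha> - 1) * ennreal (N s)"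
      using \<mu>_shrink_le[of s Q] s \<mu>_complement_finite[OF sc]
      by (simp add: minimizer_volume[OF min] eN V_def emeasure_eq_ennreal_measure)
    also have "\<dots> = ennreal (total_mass + ((1 + s) powr \<alpha> - 1) * N s)"
      using total_mass_pos N0 p1 by (simp add: ennreal_mult[symmetric] ennreal_plus[symmetric] del: ennreal_plus)
    finally have "V \<le> total_mass + ((1 + s) powr \<alpha> - 1) * N s"
      using total_mass_pos N0 p1 by (subst (asm) ennreal_le_iff) auto
    then have "(V - total_mass) / total_mass \<le> ((1 + s) powr \<alpha> - 1) * N s / total_mass" using total_mass_pos by (intro divide_right_mono) auto
    then have "V / total_mass - 1 \<le> ((1 + s) powr \<alpha> - 1) * N s / total_mass" using total_mass_pos by (simp add: diff_divide_distrib)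
    moreover have "ln (V / total_mass) \<le> V / total_mass - 1" using V total_mass_pos by (intro ln_le_minus_one) simp
    ultimately have "ln (V / total_mass) \<le> ((1 + s) powr \<alpha> - 1) * N s / total_mass" by linarith
    then have "total_mass / \<alpha> * ln (V / total_mass) \<le> total_mass / \<alpha> * (((1 + s) powr \<alpha> - 1) * N s / total_mass)"
      using total_mass_pos \<alpha> by (intro mult_left_mono) auto
    also have "\<dots> = ((1 + s) powr \<alpha> - 1) * N s / \<alpha>" using total_mass_pos by simp
    also have "\<dots> \<le> (ln (1 + s) * \<alpha> * (1 + s) powr \<alpha>) * N s / \<alpha>"
    proof -
      have "1 + - (\<alpha> * ln (1 + s)) \<le> exp (- (\<alpha> * ln (1 + s)))" by (rule exp_ge_add_one_self)
      then have "(1 - \<alpha> * ln (1 + s)) * exp (\<alpha> * ln (1 + s)) \<le> exp (- (\<alpha> * ln (1 + s))) * exp (\<alpha> * ln (1 + s))"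
        by (intro mult_right_mono) auto
      also have "\<dots> = 1" by (simp add: exp_minus)
      finally have "(1 + s) powr \<alpha> - 1 \<le> ln (1 + s) * \<alpha> * (1 + s) powr \<alpha>"
        using s by (simp add: powr_def algebra_simps)
      then show ?thesis using N0 \<alpha> by (intro divide_right_mono mult_right_mono) auto
    qed
    also have "\<dots> = ln (1 + s) * ((1 + s) powr \<alpha> * N s)" using \<alpha> by simp
    finally have "ln (1 + s) * measure \<phi> F \<le> ln (1 + s) * ((1 + s) powr \<alpha> * N s)" using Vle by linarith
    then show ?thesis using s by simp
  qed
  \<comment> \<open>Along \<open>s = 1 / (n + 1)\<close> the sets decrease and have finite measure,
    so continuity from above applies.\<close>
  define S where "S n = (C - K) \<inter> near (1 / real (Suc n)) Q" for n
  have dec: "decseq S" unfolding decseq_def S_def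
  proof safe
    fix m n :: nat and x assume "m \<le> n" "x \<in> near (1 / real (Suc n)) Q"
    moreover have "1 / real (Suc n) \<le> 1 / real (Suc m)" using \<open>m \<le> n\<close> by (simp add: frac_le)
    ultimately show "x \<in> near (1 / real (Suc m)) Q" using near_mono by blast
  qed
  have Sb: "S n \<in> sets \<mu>" for n unfolding S_def using closed_difference_borel near_borel by auto
  have fS: "emeasure \<mu> (S n) \<noteq> \<infinity>" for n using fin[of "near (1 / real (Suc n)) Q"] by (simp add: S_def)
  have lim: "(\<lambda>n. measure \<mu> (S n)) \<longlonglongrightarrow> measure \<mu> (\<Inter>n. S n)"
    using Sb fS by (intro Lim_measure_decseq dec) auto
  have "(\<lambda>n. 1 / real (Suc n)) \<longlonglongrightarrow> 0" using LIMSEQ_inverse_real_of_nat by (simp add: inverse_eq_divide)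
  then have "(\<lambda>n. (1 + 1 / real (Suc n)) powr \<alpha> * measure \<mu> (S n)) \<longlonglongrightarrow> (1 + 0) powr \<alpha> * measure \<mu> (\<Inter>n. S n)"
    by (intro tendsto_mult lim tendsto_powr tendsto_add tendsto_const) auto
  moreover have "measure \<phi> F \<le> (1 + 1 / real (Suc n)) powr \<alpha> * measure \<mu> (S n)" for n
    using key[of "1 / real (Suc n)"] by (simp add: N_def S_def)
  ultimately have "measure \<phi> F \<le> (1 + 0) powr \<alpha> * measure \<mu> (\<Inter>n. S n)"
    by (intro tendsto_lowerbound[of _ "(1 + 0) powr \<alpha> * measure \<mu> (\<Inter>n. S n)"]) auto
  also have "\<dots> = measure \<mu> (\<Inter>n. S n)" by simp
  also have "\<dots> \<le> measure \<mu> ((C - K) \<inter> touch Q)"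
  proof (rule measure_mono_fmeasurable)
    show "(\<Inter>n. S n) \<subseteq> (C - K) \<inter> touch Q" using Inter_near_subset[OF clQ] unfolding S_def by blast
    show "(\<Inter>n. S n) \<in> sets \<mu>" using Sb by auto
    show "(C - K) \<inter> touch Q \<in> fmeasurable \<mu>"
      using fin[of "touch Q"] closed_difference_borel touch_borel[OF clQ] by (intro fmeasurableI) auto
  qed
  finally show ?thesis unfolding Q_def .
qed

text \<open>Inner regularity extends the bound from compact sets to all of \<phi>. Applied to
  \<omega> and its complement, it forces equality because the cone-volume measure has total mass at
  most that of \<phi>.\<close>

lemma minimizer_solves:
  assumes min: "minimizer K" and \<omega>: "\<omega> \<in> sets \<phi>"
  shows "weighted_cone_volume \<Theta> K \<omega> = emeasure \<phi> \<omega>"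
proof -
  have CK: "C_pseudo_cone C K" using min by (simp add: minimizer_def admissible_def)
  interpret weighted_pseudo_cone C \<Theta> q K by unfold_locales (rule CK)
  have sub: "A \<in> sets borel" "A \<subseteq> Omega_dual C" if "A \<in> sets \<phi>" for A
    using that Omega_borel unfolding sets_\<phi> by (auto simp: sets_restrict_space)
  define N where "N A = emeasure \<mu> {y \<in> regular. normal_at y \<in> A}" for A
  have N_mono: "N A \<le> N B" if "A \<subseteq> B" "B \<in> sets borel" for A B
    unfolding N_def using that normal_preimage_borel[of B] by (intro emeasure_mono) auto
  \<comment> \<open>Inner regularity is a statement on Borel measures of the whole space, hence the
    push-forward along the inclusion.\<close>
  define \<phi>' where "\<phi>' = distr \<phi> borel (\<lambda>x. x)"
  have id: "(\<lambda>x. x) \<in> measurable \<phi> borel"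
    by (rule measurable_\<phi>) (simp add: measurable_restrict_space1)
  have \<phi>': "emeasure \<phi>' A = emeasure \<phi> A" if "A \<in> sets \<phi>" for A
    unfolding \<phi>'_def using sub[OF that] id
    by (subst emeasure_distr) (auto simp: space_\<phi> Int_absorb2)
  have le: "emeasure \<phi> A \<le> N A" if A: "A \<in> sets \<phi>" for A
  proof -
    have "emeasure \<phi>' (space \<phi>') \<noteq> \<infinity>"
      unfolding \<phi>'_def using id by (subst emeasure_distr) auto
    then have "emeasure \<phi>' A = (SUP F \<in> {F. F \<subseteq> A \<and> compact F}. emeasure \<phi>' F)"
      using sub[OF A] by (intro inner_regular) (auto simp: \<phi>'_def)
    also have "\<dots> \<le> N A"
    proof (rule SUP_least)
      fix F assume "F \<in> {F. F \<subseteq> A \<and> compact F}"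
      then have F: "F \<subseteq> A" "compact F" by auto
      have FO: "F \<subseteq> Omega_dual C" using F(1) sub(2)[OF A] by blast
      have Fs: "F \<in> sets \<phi>" unfolding sets_\<phi> sets_restrict_space using FO compact_imp_closed[OF F(2)] by (intro image_eqI[of _ _ F]) auto
      have "emeasure \<phi>' F = ennreal (measure \<phi> F)" using \<phi>'[OF Fs] by (simp add: emeasure_eq_measure)
      also have "\<dots> \<le> ennreal (measure \<mu> ((C - K) \<inter> touch (conic hull (uminus ` F))))"
        by (intro ennreal_leI minimizer_le_touch min F FO)
      also have "\<dots> = emeasure \<mu> ((C - K) \<inter> touch (conic hull (uminus ` F)))"
        using \<mu>_Int_complement_finite by (intro emeasure_eq_ennreal_measure[symmetric]) (auto simp: less_top)
      also have "\<dots> \<le> N F" unfolding N_def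
        using FO by (intro touch_conic_hull_le F) (auto simp: Omega_dual_def)
      also have "\<dots> \<le> N A" using F(1) sub(1)[OF A] by (rule N_mono)
      finally show "emeasure \<phi>' F \<le> N A" .
    qed
    finally show ?thesis using \<phi>'[OF A] by simp
  qed
  define \<omega>' where "\<omega>' = Omega_dual C - \<omega>"
  have \<omega>': "\<omega>' \<in> sets \<phi>" unfolding \<omega>'_def space_\<phi>[symmetric] using \<omega> by auto
  have "N \<omega> + emeasure \<phi> \<omega>' \<le> N \<omega> + N \<omega>'" by (intro add_left_mono le \<omega>')
  also have "\<dots> = N (Omega_dual C)"
  proof -
    have "{y \<in> regular. normal_at y \<in> \<omega>} \<inter> {y \<in> regular. normal_at y \<in> \<omega>'} = {}" unfolding \<omega>'_def by blast
    then have "N \<omega> + N \<omega>' = emeasure \<mu> ({y \<in> regular. normal_at y \<in> \<omega>} \<union> {y \<in> regular. normal_at y \<in> \<omega>'})"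
      unfolding N_def by (intro plus_emeasure) (simp_all add: normal_preimage_borel sub(1) \<omega> \<omega>')
    also have "{y \<in> regular. normal_at y \<in> \<omega>} \<union> {y \<in> regular. normal_at y \<in> \<omega>'} = {y \<in> regular. normal_at y \<in> Omega_dual C}"
      unfolding \<omega>'_def using sub(2)[OF \<omega>] by blast
    finally show ?thesis by (simp add: N_def)
  qed
  also have "\<dots> \<le> emeasure \<mu> (C - K)" unfolding N_def by (rule normal_preimage_le)
  also have "\<dots> = emeasure \<phi> (Omega_dual C)" by (simp add: minimizer_volume[OF min] emeasure_Omega)
  also have "Omega_dual C = \<omega> \<union> \<omega>'" unfolding \<omega>'_def using sub(2)[OF \<omega>] by blast
  also have "emeasure \<phi> (\<omega> \<union> \<omega>') = emeasure \<phi> \<omega> + emeasure \<phi> \<omega>'"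
    by (rule plus_emeasure[symmetric, OF \<omega> \<omega>']) (simp add: \<omega>'_def)
  finally have "N \<omega> \<le> emeasure \<phi> \<omega>" by (simp add: add.commute[of _ "emeasure \<phi> \<omega>'"] ennreal_add_left_cancel_le)
  then have "N \<omega> = emeasure \<phi> \<omega>" using le[OF \<omega>] by (rule antisym)
  then show ?thesis using weighted_cone_volume_eq[OF sub(1)[OF \<omega>]] by (simp add: N_def)
qed

end

section \<open>The zero measure\<close>

context weighted_cone
begin

text \<open>A normal in the interior of the dual cone at \<open>a + c\<close> satisfies both
  \<open>u \<bullet> c \<ge> 0\<close> and \<open>k * norm c \<le> - (u \<bullet> c)\<close>, so
  \<open>c = 0\<close>. At the apex all unit vectors of the dual cone are normals, which contradicts
  uniqueness.\<close>

lemma translate_volume_zero: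
  assumes a: "a \<in> interior C" and \<omega>: "\<omega> \<subseteq> Omega_dual C"
  shows "weighted_cone_volume \<Theta> ((+) a ` C) \<omega> = 0"
proof -
  define K where "K = (+) a ` C"
  have "False" if x: "x \<in> frontier K" and ex: "\<exists>!u. outer_unit_normal K x u" and g: "gauss_map K x \<in> \<omega>" for x
  proof -
    define u where "u = gauss_map K x"
    have u: "outer_unit_normal K x u" and uu: "\<And>v. outer_unit_normal K x v \<Longrightarrow> v = u"
      using theI'[OF ex] ex unfolding u_def gauss_map_def by auto
    have "closed K" using closed_C unfolding K_def by (simp add: closed_translation)
    then have "x \<in> K" using x frontier_subset_closed by blast
    then obtain c where c: "c \<in> C" "x = a + c" by (auto simp: K_def)
    have le: "u \<bullet> (y - c) \<le> 0" if "y \<in> C" for y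
    proof -
      have "a + y \<in> K" using that by (simp add: K_def)
      then have "u \<bullet> (a + y - x) \<le> 0" using u unfolding outer_unit_normal_def by blast
      then show ?thesis by (simp add: c)
    qed
    have uI: "u \<in> interior (dual_cone C)" and un: "norm u = 1"
      using g \<omega> Omega_dual_D unfolding u_def by blast+
    obtain k where k: "k > 0" "\<And>y. y \<in> C \<Longrightarrow> k * norm y \<le> - (u \<bullet> y)" using interior_dual_gap[OF uI] by blast
    have "u \<bullet> c \<ge> 0" using le[OF zero_C] by simp
    then have "k * norm c \<le> 0" using k(2)[OF c(1)] by linarith
    then have xa: "x = a" using k(1) c(2) by (simp add: mult_le_0_iff)
    have normal: "outer_unit_normal K x v" if "v \<in> dual_cone C" "norm v = 1" for v
      using that unfolding outer_unit_normal_def K_def xa by (auto simp: dual_cone_def)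
    have "interior (dual_cone C) \<noteq> {}" using uI by blast
    then interpret D: solid_cone "dual_cone C" by (rule solid_cone_dual)
    obtain e where e: "e > 0" "cball u e \<subseteq> dual_cone C" using uI mem_interior_cball by blast
    \<comment> \<open>Dimension at least 2 enters here: tilting \<open>u\<close> by
      \<open>e w\<close> gives a second normal direction.\<close>
    have "\<exists>w::'a. norm w = 1 \<and> u \<bullet> w = 0"
    proof -
      have "u \<noteq> 0" using un by auto
      then obtain S where S: "u \<in> S" "0 \<notin> S" "pairwise orthogonal S" "card S = DIM('a)"
        using vector_in_orthogonal_basis by metis
      have "\<not> S \<subseteq> {u}" using card_mono[of "{u}" S] S(4) dim2 by auto
      then obtain w where w: "w \<in> S" "w \<noteq> u" by blast
      then have "u \<bullet> w = 0" "w \<noteq> 0" using S by (auto simp: pairwise_def orthogonal_def)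
      then show ?thesis by (intro exI[of _ "(1 / norm w) *\<^sub>R w"]) simp
    qed
    then obtain w where w: "norm w = 1" "u \<bullet> w = 0" by blast
    define v where "v = u + e *\<^sub>R w"
    have "v \<in> dual_cone C" using e w by (intro subsetD[OF e(2)]) (simp add: v_def dist_norm)
    moreover have uv: "u \<bullet> v = 1" using w(2) un by (simp add: v_def inner_add_right dot_square_norm)
    then have v0: "v \<noteq> 0" by auto
    ultimately have "outer_unit_normal K x ((1 / norm v) *\<^sub>R v)" using D.scale_C by (intro normal) auto
    then have eq: "(1 / norm v) *\<^sub>R v = u" by (rule uu)
    then have "w \<bullet> v = 0" using w(2) v0 by (metis inner_commute inner_scaleR_right mult_eq_0_iff divide_eq_0_iff norm_eq_zero zero_neq_one)
    then show False using w e(1) by (simp add: v_def inner_add_right inner_commute dot_square_norm)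
  qed
  then have "reverse_gauss_image K \<omega> = {}" unfolding reverse_gauss_image_def by blast
  then show ?thesis by (simp add: weighted_cone_volume_def weighted_volume_def K_def)
qed

end

section \<open>The existence theorem\<close>

theorem theorem2:
  fixes C :: "'a::euclidean_space set"
    and \<Theta> :: "'a \<Rightarrow> real"
    and q :: real
    and \<phi> :: "'a measure"
  assumes "DIM('a) \<ge> 2"
    and "pointed_closed_convex_cone C"
    and "interior C \<noteq> {}"
    and "continuous_on (C - {0}) \<Theta>"
    and "\<And>y. y \<in> C - {0} \<Longrightarrow> \<Theta> y > 0"
    and "\<And>y t. y \<in> C - {0} \<Longrightarrow> t > 0 \<Longrightarrow> \<Theta> (t *\<^sub>R y) = t powr (- q) * \<Theta> y"
    and "real DIM('a) - 1 < q" and "q < real DIM('a)"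
    and "sets \<phi> = sets (restrict_space borel (Omega_dual C))"
  shows "(\<exists>K. C_pseudo_cone C K \<and>
            (\<forall>\<omega> \<in> sets \<phi>. weighted_cone_volume \<Theta> K \<omega> = emeasure \<phi> \<omega>))
         \<longleftrightarrow> finite_measure \<phi>"
proof -
  interpret weighted_cone C \<Theta> q
    using assms(1-8) by unfold_locales
  have borel_\<phi>: "\<omega> \<in> sets borel" "\<omega> \<subseteq> Omega_dual C" if "\<omega> \<in> sets \<phi>" for \<omega>
    using that Omega_borel unfolding assms(9) by (auto simp: sets_restrict_space)
  have space_\<phi>: "space \<phi> = Omega_dual C"
    using sets_eq_imp_space_eq[OF assms(9)] by (simp add: space_restrict_space)
  show ?thesis
  proof
    assume "\<exists>K. C_pseudo_cone C K \<and> (\<forall>\<omega> \<in> sets \<phi>. weighted_cone_volume \<Theta> K \<omega> = emeasure \<phi> \<omega>)"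
    then obtain K where K: "C_pseudo_cone C K"
      and eq: "\<And>\<omega>. \<omega> \<in> sets \<phi> \<Longrightarrow> weighted_cone_volume \<Theta> K \<omega> = emeasure \<phi> \<omega>" by blast
    interpret weighted_pseudo_cone C \<Theta> q K by unfold_locales (rule K)
    have "emeasure \<phi> (space \<phi>) = weighted_cone_volume \<Theta> K (Omega_dual C)"
      using eq[OF sets.top] by (simp add: space_\<phi>)
    then show "finite_measure \<phi>" using weighted_cone_volume_finite by (intro finite_measureI) simp
  next
    assume fin: "finite_measure \<phi>"
    show "\<exists>K. C_pseudo_cone C K \<and> (\<forall>\<omega> \<in> sets \<phi>. weighted_cone_volume \<Theta> K \<omega> = emeasure \<phi> \<omega>)"
    proof (cases "emeasure \<phi> (Omega_dual C) = 0")
      case True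
      obtain a where a: "a \<in> interior C" using solid by blast
      have "weighted_cone_volume \<Theta> ((+) a ` C) \<omega> = emeasure \<phi> \<omega>" if "\<omega> \<in> sets \<phi>" for \<omega>
      proof -
        have "emeasure \<phi> \<omega> \<le> 0" using emeasure_space[of \<phi> \<omega>] True by (simp add: space_\<phi>)
        then show ?thesis using translate_volume_zero[OF a borel_\<phi>(2)[OF that]] by simp
      qed
      then show ?thesis using C_pseudo_cone_translate[OF a] by blast
    next
      case False
      interpret prescribed_measure C \<Theta> q \<phi>
        by (intro prescribed_measure.intro weighted_cone_axioms prescribed_measure_axioms.intro assms(9) fin False)
      obtain K where K: "minimizer K" by (rule minimizer_exists)
      then have "C_pseudo_cone C K" by (simp add: minimizer_def admissible_def)
      then show ?thesis using minimizer_solves[OF K] by blast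
    qed
  qed
qed

end
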